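(* Let $G=NL$ be an lcsc group which is the semidirect product of a closed normal subgroup $N$ and a closed subgroup $L$ ($N\cap L=\{e\}$), where $N$ and $L$ are unimodular and the conjugation action of $L$ on $N$ preserves the Haar measure of $N$. Let $G$ act by a Borel action on a Polish space $X$ with separated cross section $Z$, and put $Y:=L.Z$. If $Y$ is a separated cross section for the $N$-action on $X$, then for every finite $G$-invariant Borel measure $\mu$ on $X$ the measure ${}^{N}\mathrm{res}^{X}_{Y}(\mu)$ on $Y$ is finite and $L$-invariant, and $${}^{G}\mathrm{res}^{X}_{Z}(\mu)={}^{L}\mathrm{res}^{Y}_{Z}\big({}^{N}\mathrm{res}^{X}_{Y}(\mu)\big).$$
   Context: lcsc = locally compact second countable. Haar measures are normalized so that $m_G(W_NW_L)=m_N(W_N)m_L(W_L)$ for all Borel $W_N\subset N$, $W_L\subset L$. For a Borel action of an lcsc group $H$ on a standard Borel space $S$, a Borel set $T\subset S$ is a cross section if $H.T=S$; it is separated if $\{h\in H: h.T\cap T\ne\emptyset\}\cap U=\{e\}$ for some identity neighbourhood $U$ in $H$. For $s\in S$, $T_s:=\{h\in H:h.s\in T\}$. If $T$ is a separated cross section and $\mu$ is a finite $H$-invariant Borel measure on $S$, then ${}^{H}\mathrm{res}^{S}_{T}(\mu)$ denotes the transverse measure of $\mu$, i.e. the unique Borel measure $\nu$ on $T$ such that for all bounded non-negative Borel $f$ on $H\times T$, $$\int_S\sum_{h\in T_s}f(h^{-1},h.s)\,d\mu(s)=\int_H\int_T f(h,t)\,d\nu(t)\,dm_H(h).$$ In the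 setting of the claim, $Y$ is an $L$-invariant Borel subset of $X$, $Z$ is a separated cross section for the $L$-action on $Y$, and $Y$ is always a (not necessarily separated) cross section for the $N$-action on $X$. *)

theory Defs
  imports "HOL-Analysis.Analysis"
begin

text \<open>
  Groups are written additively: the classes \<^class>\<open>group_add\<close> and
  \<^class>\<open>topological_group_add\<close> do not assume commutativity.  So \<open>g + h\<close>, \<open>0\<close>, \<open>- g\<close> stand for
  $gh$, $e$, $g^{-1}$.  The ambient group is a type; a closed subgroup \<open>H\<close> is a set in it,
  with the subspace topology and the Borel structure \<open>restrict_space borel H\<close>.
  The ambient group itself is the case \<open>H = UNIV\<close>.
\<close>

definition closed_subgroup :: "'g::topological_group_add set \<Rightarrow> bool" where
  "closed_subgroup H \<longleftrightarrow>
     closed H \<and> 0 \<in> H \<and> (\<forall>g\<in>H. \<forall>h\<in>H. g + h \<in> H) \<and> (\<forall>g\<in>H. - g \<in> H)"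

definition normal_subgroup :: "'g::topological_group_add set \<Rightarrow> bool" where
  "normal_subgroup N \<longleftrightarrow> (\<forall>g. \<forall>n\<in>N. g + n - g \<in> N)"

definition set_product :: "'g::plus set \<Rightarrow> 'g set \<Rightarrow> 'g set" where
  "set_product A B = {a + b |a b. a \<in> A \<and> b \<in> B}"

text \<open>
  Left Haar measures.  In a locally compact second countable Hausdorff group every Borel measure
  that is finite on compact sets is regular, so regularity is not listed.
\<close>

definition haar_measure :: "'g::topological_group_add set \<Rightarrow> 'g measure \<Rightarrow> bool" where
  "haar_measure H m \<longleftrightarrow>
     sets m = sets (restrict_space borel H) \<and>
     (\<forall>h\<in>H. distr m m (\<lambda>x. h + x) = m) \<and>
     (\<forall>K. compact K \<and> K \<subseteq> H \<longrightarrow> emeasure m K < \<infinity>) \<and>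
     emeasure m H \<noteq> 0"

definition unimodular :: "'g::topological_group_add set \<Rightarrow> bool" where
  "unimodular H \<longleftrightarrow>
     (\<forall>m. haar_measure H m \<longrightarrow> (\<forall>h\<in>H. distr m m (\<lambda>x. x + h) = m))"

text \<open>
  A Borel action of \<open>H\<close> on the standard Borel space \<open>S\<close>, a Borel subset of a Polish space.
\<close>

definition borel_action ::
  "'g::topological_group_add set \<Rightarrow> 'x::polish_space set \<Rightarrow> ('g \<Rightarrow> 'x \<Rightarrow> 'x) \<Rightarrow> bool" where
  "borel_action H S act \<longleftrightarrow>
     S \<in> sets borel \<and>
     (\<forall>s\<in>S. act 0 s = s) \<and>
     (\<forall>g\<in>H. \<forall>h\<in>H. \<forall>s\<in>S. act (g + h) s = act g (act h s)) \<and>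
     (\<lambda>(h, s). act h s) \<in>
       measurable (restrict_space borel H \<Otimes>\<^sub>M restrict_space borel S) (restrict_space borel S)"

definition translates :: "('g \<Rightarrow> 'x \<Rightarrow> 'x) \<Rightarrow> 'g set \<Rightarrow> 'x set \<Rightarrow> 'x set" where
  "translates act H T = (\<Union>h\<in>H. act h ` T)"

definition cross_section ::
  "'g set \<Rightarrow> ('g \<Rightarrow> 'x \<Rightarrow> 'x) \<Rightarrow> 'x::polish_space set \<Rightarrow> 'x set \<Rightarrow> bool" where
  "cross_section H act S T \<longleftrightarrow>
     T \<subseteq> S \<and> T \<in> sets (restrict_space borel S) \<and> translates act H T = S"

definition separated ::
  "'g::topological_group_add set \<Rightarrow> ('g \<Rightarrow> 'x \<Rightarrow> 'x) \<Rightarrow> 'x set \<Rightarrow> bool" where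
  "separated H act T \<longleftrightarrow>
     (\<exists>U. openin (top_of_set H) U \<and> 0 \<in> U \<and>
          {h \<in> H. act h ` T \<inter> T \<noteq> {}} \<inter> U = {0})"

definition hitting_set :: "'g set \<Rightarrow> ('g \<Rightarrow> 'x \<Rightarrow> 'x) \<Rightarrow> 'x set \<Rightarrow> 'x \<Rightarrow> 'g set" where
  "hitting_set H act T s = {h \<in> H. act h s \<in> T}"

definition finite_invariant_borel_measure ::
  "'g set \<Rightarrow> ('g \<Rightarrow> 'x \<Rightarrow> 'x) \<Rightarrow> 'x::polish_space set \<Rightarrow> 'x measure \<Rightarrow> bool" where
  "finite_invariant_borel_measure H act S \<mu> \<longleftrightarrow>
     sets \<mu> = sets (restrict_space borel S) \<and> finite_measure \<mu> \<and>
     (\<forall>h\<in>H. distr \<mu> \<mu> (act h) = \<mu>)"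

text \<open>
  The defining identity of the transverse measure.  The sum over the hitting set is the integral
  against counting measure; both sides take values in $[0,\infty]$.
\<close>

definition is_transverse_measure ::
  "'g::topological_group_add set \<Rightarrow> 'g measure \<Rightarrow> ('g \<Rightarrow> 'x \<Rightarrow> 'x) \<Rightarrow> 'x::polish_space set \<Rightarrow>
     'x measure \<Rightarrow> 'x measure \<Rightarrow> bool" where
  "is_transverse_measure H m act T \<mu> \<nu> \<longleftrightarrow>
     sets \<nu> = sets (restrict_space borel T) \<and>
     (\<forall>f::'g \<times> 'x \<Rightarrow> real.
        f \<in> borel_measurable (restrict_space borel H \<Otimes>\<^sub>M restrict_space borel T) \<and>
        (\<forall>p\<in>H \<times> T. 0 \<le> f p) \<and> bounded (f ` (H \<times> T)) \<longrightarrow>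
        (\<integral>\<^sup>+ s. (\<integral>\<^sup>+ h. ennreal (f (- h, act h s)) \<partial>count_space (hitting_set H act T s)) \<partial>\<mu>)
        = (\<integral>\<^sup>+ h. (\<integral>\<^sup>+ t. ennreal (f (h, t)) \<partial>\<nu>) \<partial>m))"

definition transverse_measure ::
  "'g::topological_group_add set \<Rightarrow> 'g measure \<Rightarrow> ('g \<Rightarrow> 'x \<Rightarrow> 'x) \<Rightarrow> 'x::polish_space set \<Rightarrow>
     'x measure \<Rightarrow> 'x measure" where
  "transverse_measure H m act T \<mu> = (THE \<nu>. is_transverse_measure H m act T \<mu> \<nu>)"

end

theory Submission
  imports Defs
begin

text \<open>
  For \<open>g\<close> with \<open>g x \<in> Z\<close> write \<open>g = l n\<close> with \<open>n \<in> N\<close>, \<open>l \<in> L\<close>; then \<open>n x \<in> Y\<close>, so the hitting sum of \<open>Z\<close>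
  for \<open>G\<close> is a hitting sum of \<open>Y\<close> for \<open>N\<close> followed by one of \<open>Z\<close> for \<open>L\<close>.  Applying the defining identities
  of the two restrictions one after the other, and the factorization of \<open>m\<^sub>G\<close>, gives the defining
  identity for \<open>G\<close>; uniqueness finishes the proof, and it also yields the \<open>L\<close>-invariance.

  A transverse measure exists because \<open>f \<mapsto> \<integral> \<Sum> f(h\<^sup>-\<^sup>1, h.s) d\<mu>(s)\<close> is invariant under left translation in
  the \<open>H\<close>-coordinate, so that averaging over a compact symmetric subset of \<open>H\<close> disintegrates it along
  Haar measure.  The hitting sums need not be obviously Borel in \<open>s\<close>, but they are measurable for the
  completion of \<open>\<mu>\<close>: \<open>T\<^sub>s\<close> meets each piece of a fine countable partition of \<open>H\<close> in at most one point, and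
  this point depends measurably on \<open>s\<close> by the measurable projection theorem.
\<close>

section \<open>Suslin sets and projections\<close>

lemma bounded_branch_exists:
  fixes Q :: "nat \<Rightarrow> (nat \<Rightarrow> nat) \<Rightarrow> bool" and b :: "nat \<Rightarrow> nat"
  assumes dep: "\<And>k \<sigma> \<tau>. (\<And>i. i \<le> k \<Longrightarrow> \<sigma> i = \<tau> i) \<Longrightarrow> Q k \<sigma> \<Longrightarrow> Q k \<tau>"
    and dec: "\<And>j k \<sigma>. j \<le> k \<Longrightarrow> Q k \<sigma> \<Longrightarrow> Q j \<sigma>"
    and ex: "\<And>k. \<exists>\<sigma>. (\<forall>i. \<sigma> i \<le> b i) \<and> Q k \<sigma>"
  shows "\<exists>\<sigma>. (\<forall>i. \<sigma> i \<le> b i) \<and> (\<forall>k. Q k \<sigma>)"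
proof -
  let ?M = "{\<sigma>::nat \<Rightarrow> nat. \<forall>i. \<sigma> i \<le> b i}"
  have "compactin (product_topology (\<lambda>i. euclidean) UNIV) (PiE UNIV (\<lambda>i. {..b i}))"
    unfolding compactin_PiE by (simp add: finite_imp_compact)
  moreover have "PiE UNIV (\<lambda>i. {..b i}) = ?M"
    by (auto simp: PiE_def)
  ultimately have "compact ?M"
    by (simp add: euclidean_product_topology)
  then have sc: "seq_compact ?M"
    by (simp add: seq_compact_eq_compact)
  obtain s where s: "\<And>k. s k \<in> ?M" "\<And>k. Q k (s k)"
    using choice[of "\<lambda>k \<sigma>. (\<forall>i. \<sigma> i \<le> b i) \<and> Q k \<sigma>"] ex by blast
  obtain \<sigma> r where \<sigma>: "\<sigma> \<in> ?M" "strict_mono (r :: nat \<Rightarrow> nat)" "(s \<circ> r) \<longlonglongrightarrow> \<sigma>"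
    using s(1) by (auto intro: seq_compactE[OF sc, of s])
  have "Q k \<sigma>" for k
  proof -
    have "eventually (\<lambda>m. (s \<circ> r) m i = \<sigma> i) sequentially" for i
    proof -
      have "((\<lambda>m. (s \<circ> r) m i) \<longlongrightarrow> \<sigma> i) sequentially"
        using continuous_on_tendsto_compose[OF continuous_on_product_coordinates \<sigma>(3)] by simp
      then show ?thesis
        by (simp add: tendsto_discrete)
    qed
    then have "eventually (\<lambda>m. \<forall>i\<in>{..k}. (s \<circ> r) m i = \<sigma> i) sequentially"
      by (intro eventually_ball_finite) auto
    moreover have "eventually (\<lambda>m. k \<le> m) sequentially"
      by (rule eventually_ge_at_top)
    ultimately have "eventually (\<lambda>m. (\<forall>i\<in>{..k}. (s \<circ> r) m i = \<sigma> i) \<and> k \<le> m) sequentially"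
      by (rule eventually_conj)
    then obtain m where m: "\<And>i. i \<le> k \<Longrightarrow> s (r m) i = \<sigma> i" "k \<le> m"
      by (auto simp: eventually_sequentially)
    have "Q k (s (r m))"
      using dec[OF _ s(2)] m(2) seq_suble[OF \<sigma>(2)] le_trans by blast
    then show ?thesis
      using dep m(1) by blast
  qed
  with \<sigma>(1) show ?thesis by blast
qed

definition suslin_scheme ::
  "'w measure \<Rightarrow> (nat \<Rightarrow> (nat \<Rightarrow> nat) \<Rightarrow> 'h::topological_space set) \<Rightarrow> (nat \<Rightarrow> (nat \<Rightarrow> nat) \<Rightarrow> 'w set) \<Rightarrow> bool"
where
  "suslin_scheme M F B \<longleftrightarrow>
     (\<forall>k \<sigma>. compact (F k \<sigma>) \<and> B k \<sigma> \<in> sets M) \<and>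
     (\<forall>k \<sigma> \<tau>. (\<forall>i\<le>k. \<sigma> i = \<tau> i) \<longrightarrow> F k \<sigma> = F k \<tau> \<and> B k \<sigma> = B k \<tau>)"

lemma suslin_schemeD:
  assumes "suslin_scheme M F B"
  shows "compact (F k \<sigma>)" "B k \<sigma> \<in> sets M"
    "(\<And>i. i \<le> k \<Longrightarrow> \<sigma> i = \<tau> i) \<Longrightarrow> F k \<sigma> = F k \<tau> \<and> B k \<sigma> = B k \<tau>"
  using assms unfolding suslin_scheme_def by simp_all

definition scheme_set ::
  "(nat \<Rightarrow> (nat \<Rightarrow> nat) \<Rightarrow> 'h set) \<Rightarrow> (nat \<Rightarrow> (nat \<Rightarrow> nat) \<Rightarrow> 'w set) \<Rightarrow> ('h \<times> 'w) set"
where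
  "scheme_set F B = (\<Union>\<sigma>. \<Inter>k. F k \<sigma> \<times> B k \<sigma>)"

definition suslin :: "'w measure \<Rightarrow> ('h::topological_space \<times> 'w) set \<Rightarrow> bool" where
  "suslin M A \<longleftrightarrow> (\<exists>F B. suslin_scheme M F B \<and> A = scheme_set F B)"

lemma suslin_seqE:
  assumes "\<And>n::nat. suslin M (A n)"
  obtains F B where "\<And>n. suslin_scheme M (F n) (B n)"
    "\<And>n. A n = scheme_set (F n) (B n)"
  using assms unfolding suslin_def by metis

lemma suslin_Times: "compact C \<Longrightarrow> D \<in> sets M \<Longrightarrow> suslin M (C \<times> D)"
  unfolding suslin_def suslin_scheme_def scheme_set_def
  by (intro exI[of _ "\<lambda>_ _. C"] exI[of _ "\<lambda>_ _. D"]) auto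

lemma suslin_UN:
  assumes "\<And>n::nat. suslin M (A n)"
  shows "suslin M (\<Union>n. A n)"
proof -
  obtain F B where FB: "\<And>n. suslin_scheme M (F n) (B n)"
    and A': "\<And>n. A n = scheme_set (F n) (B n)"
    using suslin_seqE[of M A] assms by metis
  have A: "A n = (\<Union>\<sigma>. \<Inter>k. F n k \<sigma> \<times> B n k \<sigma>)" for n
    using A' by (simp add: scheme_set_def)
  define n where "n \<sigma> = fst (prod_decode (\<sigma> 0))" for \<sigma> :: "nat \<Rightarrow> nat"
  define r where "r \<sigma> = \<sigma>(0 := snd (prod_decode (\<sigma> 0)))" for \<sigma> :: "nat \<Rightarrow> nat"
  have agree: "n \<sigma> = n \<tau> \<and> (\<forall>i\<le>k. r \<sigma> i = r \<tau> i)" if "\<forall>i\<le>k. \<sigma> i = \<tau> i" for k \<sigma> \<tau>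
    using that by (auto simp: n_def r_def)
  have "(\<Union>n. A n) = (\<Union>\<sigma>. \<Inter>k. F (n \<sigma>) k (r \<sigma>) \<times> B (n \<sigma>) k (r \<sigma>))"
  proof (intro subset_antisym subsetI)
    fix x assume "x \<in> (\<Union>n. A n)"
    then obtain m \<tau> where *: "\<And>k. x \<in> F m k \<tau> \<times> B m k \<tau>"
      unfolding A by blast
    have "n (\<tau>(0 := prod_encode (m, \<tau> 0))) = m" "r (\<tau>(0 := prod_encode (m, \<tau> 0))) = \<tau>"
      by (auto simp: n_def r_def)
    then show "x \<in> (\<Union>\<sigma>. \<Inter>k. F (n \<sigma>) k (r \<sigma>) \<times> B (n \<sigma>) k (r \<sigma>))"
      using * by (intro UN_I[of "\<tau>(0 := prod_encode (m, \<tau> 0))"]) auto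
  next
    fix x assume "x \<in> (\<Union>\<sigma>. \<Inter>k. F (n \<sigma>) k (r \<sigma>) \<times> B (n \<sigma>) k (r \<sigma>))"
    then obtain \<sigma> where "x \<in> (\<Inter>k. F (n \<sigma>) k (r \<sigma>) \<times> B (n \<sigma>) k (r \<sigma>))" by blast
    then have "x \<in> A (n \<sigma>)" unfolding A by (intro UN_I[of "r \<sigma>"]) auto
    then show "x \<in> (\<Union>n. A n)" by blast
  qed
  moreover have "suslin_scheme M (\<lambda>k \<sigma>. F (n \<sigma>) k (r \<sigma>)) (\<lambda>k \<sigma>. B (n \<sigma>) k (r \<sigma>))"
    unfolding suslin_scheme_def
  proof (intro conjI allI impI)
    fix k and \<sigma> \<tau> :: "nat \<Rightarrow> nat" assume "\<forall>i\<le>k. \<sigma> i = \<tau> i"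
    then show "F (n \<sigma>) k (r \<sigma>) = F (n \<tau>) k (r \<tau>)" "B (n \<sigma>) k (r \<sigma>) = B (n \<tau>) k (r \<tau>)"
      using agree[of k \<sigma> \<tau>] suslin_schemeD(3)[OF FB, of k "r \<sigma>" "r \<tau>" "n \<tau>"] by auto
  qed (use suslin_schemeD(1,2)[OF FB] in auto)
  ultimately show ?thesis
    unfolding suslin_def scheme_set_def by blast
qed

lemma suslin_INT:
  assumes "\<And>n::nat. suslin M (A n)"
  shows "suslin M (\<Inter>n. A n)"
proof -
  obtain F B where FB: "\<And>n. suslin_scheme M (F n) (B n)"
    and A': "\<And>n. A n = scheme_set (F n) (B n)"
    using suslin_seqE[of M A] assms by metis
  have A: "A n = (\<Union>\<sigma>. \<Inter>k. F n k \<sigma> \<times> B n k \<sigma>)" for n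
    using A' by (simp add: scheme_set_def)
  define r where "r n \<sigma> = (\<lambda>i. \<sigma> (prod_encode (n, i)))" for n :: nat and \<sigma> :: "nat \<Rightarrow> nat"
  define p where "p k = fst (prod_decode k)" for k
  define q where "q k = snd (prod_decode k)" for k
  have mono: "prod_encode (n, i) \<le> prod_encode (n, j)" if "i \<le> j" for n i j
    using that by (induction rule: dec_induct) (auto simp: prod_encode_def)
  have agree: "\<forall>i\<le>q k. r (p k) \<sigma> i = r (p k) \<tau> i" if "\<forall>i\<le>k. \<sigma> i = \<tau> i" for k \<sigma> \<tau>
  proof (intro allI impI)
    fix i assume "i \<le> q k"
    then have "prod_encode (p k, i) \<le> prod_encode (p k, q k)" by (rule mono)
    also have "\<dots> = k" by (simp add: p_def q_def)
    finally show "r (p k) \<sigma> i = r (p k) \<tau> i" using that by (simp add: r_def)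
  qed
  have "(\<Inter>n. A n) = (\<Union>\<sigma>. \<Inter>k. F (p k) (q k) (r (p k) \<sigma>) \<times> B (p k) (q k) (r (p k) \<sigma>))"
  proof (intro subset_antisym subsetI)
    fix x assume "x \<in> (\<Inter>n. A n)"
    then have "x \<in> A n" for n by blast
    then have "\<forall>n. \<exists>\<tau>. \<forall>k. x \<in> F n k \<tau> \<times> B n k \<tau>"
      unfolding A by (simp only: UN_iff INT_iff) simp
    then obtain \<tau> where *: "\<And>n k. x \<in> F n k (\<tau> n) \<times> B n k (\<tau> n)"
      by (drule_tac choice) blast
    have "r n (\<lambda>j. \<tau> (p j) (q j)) = \<tau> n" for n
      by (auto simp: r_def p_def q_def)
    then show "x \<in> (\<Union>\<sigma>. \<Inter>k. F (p k) (q k) (r (p k) \<sigma>) \<times> B (p k) (q k) (r (p k) \<sigma>))"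
      using * by (intro UN_I[of "\<lambda>j. \<tau> (p j) (q j)"]) auto
  next
    fix x assume "x \<in> (\<Union>\<sigma>. \<Inter>k. F (p k) (q k) (r (p k) \<sigma>) \<times> B (p k) (q k) (r (p k) \<sigma>))"
    then obtain \<sigma> where *: "\<And>k. x \<in> F (p k) (q k) (r (p k) \<sigma>) \<times> B (p k) (q k) (r (p k) \<sigma>)"
      by blast
    have "x \<in> F n k (r n \<sigma>) \<times> B n k (r n \<sigma>)" for n k
      using *[of "prod_encode (n, k)"] by (simp add: p_def q_def)
    then have "x \<in> A n" for n
      unfolding A by (intro UN_I[of "r n \<sigma>"]) auto
    then show "x \<in> (\<Inter>n. A n)" by blast
  qed
  moreover have "suslin_scheme M (\<lambda>k \<sigma>. F (p k) (q k) (r (p k) \<sigma>)) (\<lambda>k \<sigma>. B (p k) (q k) (r (p k) \<sigma>))"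
    unfolding suslin_scheme_def
  proof (intro conjI allI impI)
    fix k and \<sigma> \<tau> :: "nat \<Rightarrow> nat" assume "\<forall>i\<le>k. \<sigma> i = \<tau> i"
    then show "F (p k) (q k) (r (p k) \<sigma>) = F (p k) (q k) (r (p k) \<tau>)"
      "B (p k) (q k) (r (p k) \<sigma>) = B (p k) (q k) (r (p k) \<tau>)"
      using agree[of k \<sigma> \<tau>] suslin_schemeD(3)[OF FB, of "q k" "r (p k) \<sigma>" "r (p k) \<tau>" "p k"]
      by auto
  qed (use suslin_schemeD(1,2)[OF FB] in auto)
  ultimately show ?thesis
    unfolding suslin_def scheme_set_def by blast
qed

lemma suslin_Un: "suslin M A \<Longrightarrow> suslin M B \<Longrightarrow> suslin M (A \<union> B)"
proof -
  assume "suslin M A" "suslin M B"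
  then have "suslin M (\<Union>n::nat. if n = 0 then A else B)"
    by (intro suslin_UN) auto
  also have "(\<Union>n::nat. if n = 0 then A else B) = A \<union> B"
    by (auto split: if_splits)
  finally show ?thesis .
qed

text \<open>Choquet's capacity argument: bounding the branches one coordinate at a time loses
  arbitrarily little outer measure, and over a bounded set of branches compactness makes the
  projection commute with the intersection.\<close>

lemma suslin_projection_inner:
  fixes A :: "('h::t2_space \<times> 'w) set"
  assumes A: "suslin M A" and fin: "outer_measure_of M (snd ` A) < \<infinity>"
    and r: "r < outer_measure_of M (snd ` A)"
  shows "\<exists>D\<in>sets M. D \<subseteq> snd ` A \<and> r \<le> emeasure M D"
proof -
  obtain F B where scheme: "suslin_scheme M F B" and A_eq: "A = (\<Union>\<sigma>. \<Inter>k. F k \<sigma> \<times> B k \<sigma>)"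
    using A unfolding suslin_def scheme_set_def by blast
  note FB = suslin_schemeD(1,2)[OF scheme] and dep = suslin_schemeD(3)[OF scheme]
  have sub: "snd ` A \<subseteq> space M"
    using sets.sets_into_space[OF FB(2)] unfolding A_eq by fastforce
  obtain W where W: "W \<in> sets M" "snd ` A \<subseteq> W" "outer_measure_of M (snd ` A) = emeasure M W"
    using outer_measure_of_attain[OF sub] by blast
  define P where "P j n = {w. \<exists>\<sigma> h. (\<forall>i<j. \<sigma> i \<le> n i) \<and> (\<forall>k. (h, w) \<in> F k \<sigma> \<times> B k \<sigma>)}"
    for j :: nat and n :: "nat \<Rightarrow> nat"
  have P_sub: "P j n \<subseteq> snd ` A" for j n
    unfolding P_def A_eq by (force simp: image_iff)
  have P0: "P 0 n = snd ` A" for n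
    unfolding P_def A_eq by (force simp: image_iff)
  have P_cong: "P j n = P j m" if "\<forall>i<j. n i = m i" for j n m
    using that unfolding P_def by auto
  have step: "\<exists>m. r < outer_measure_of M (P (Suc j) m) \<and> (\<forall>i<j. m i = n i)"
    if "r < outer_measure_of M (P j n)" for j n
  proof -
    have UN: "(\<Union>m. P (Suc j) (n(j := m))) = P j n"
    proof (intro subset_antisym subsetI)
      fix w assume "w \<in> P j n"
      then obtain \<sigma> h where *: "\<forall>i<j. \<sigma> i \<le> n i" "\<forall>k. (h, w) \<in> F k \<sigma> \<times> B k \<sigma>"
        unfolding P_def by blast
      then have "w \<in> P (Suc j) (n(j := \<sigma> j))"
        unfolding P_def by (auto simp: less_Suc_eq intro!: exI[of _ \<sigma>])
      then show "w \<in> (\<Union>m. P (Suc j) (n(j := m)))" by blast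
    next
      fix w assume "w \<in> (\<Union>m. P (Suc j) (n(j := m)))"
      then obtain m \<sigma> h where *: "\<forall>i<Suc j. \<sigma> i \<le> (n(j := m)) i" "\<forall>k. (h, w) \<in> F k \<sigma> \<times> B k \<sigma>"
        unfolding P_def by blast
      have "\<forall>i<j. \<sigma> i \<le> n i"
        using *(1) by (metis fun_upd_other less_SucI less_irrefl)
      with *(2) show "w \<in> P j n" unfolding P_def by blast
    qed
    have "incseq (\<lambda>m. P (Suc j) (n(j := m)))"
    proof (rule incseq_SucI, rule subsetI)
      fix m w assume "w \<in> P (Suc j) (n(j := m))"
      then obtain \<sigma> h where *: "\<forall>i<Suc j. \<sigma> i \<le> (n(j := m)) i" "\<forall>k. (h, w) \<in> F k \<sigma> \<times> B k \<sigma>"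
        unfolding P_def by blast
      have "\<forall>i<Suc j. \<sigma> i \<le> (n(j := Suc m)) i"
        using *(1) by (metis fun_upd_apply le_SucI)
      with *(2) show "w \<in> P (Suc j) (n(j := Suc m))" unfolding P_def by blast
    qed
    then have "(SUP m. outer_measure_of M (P (Suc j) (n(j := m)))) = outer_measure_of M (P j n)"
      using SUP_outer_measure_of_incseq[of "\<lambda>m. P (Suc j) (n(j := m))" M]
        order_trans[OF P_sub sub] UN by simp
    with that obtain m where "r < outer_measure_of M (P (Suc j) (n(j := m)))"
      by (metis less_SUP_iff)
    then show ?thesis by (intro exI[of _ "n(j := m)"]) auto
  qed
  have "\<exists>f. \<forall>j. r < outer_measure_of M (P j (f j)) \<and> (\<forall>i<j. f (Suc j) i = f j i)"
    using r P0 step by (intro dependent_nat_choice) auto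
  then obtain f where f: "\<And>j. r < outer_measure_of M (P j (f j))"
    "\<And>i j. i < j \<Longrightarrow> f (Suc j) i = f j i"
    by blast
  define b where "b i = f (Suc i) i" for i
  have fb: "f j i = b i" if "i < j" for i j
    using that by (induction j) (auto simp: less_Suc_eq f(2) b_def)
  then have Pb: "r < outer_measure_of M (P j b)" for j
    using f(1) P_cong by metis
  define Q where "Q w j \<sigma> \<longleftrightarrow> (\<Inter>k\<in>{..j}. F k \<sigma>) \<noteq> {} \<and> w \<in> (\<Inter>k\<in>{..j}. B k \<sigma>)" for w j \<sigma>
  have Q_dep: "Q w k \<tau>" if "\<And>i. i \<le> k \<Longrightarrow> \<sigma> i = \<tau> i" "Q w k \<sigma>" for w k \<sigma> \<tau>
  proof -
    have "F l \<sigma> = F l \<tau> \<and> B l \<sigma> = B l \<tau>" if "l \<le> k" for l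
      using dep[of l \<sigma> \<tau>] \<open>\<And>i. i \<le> k \<Longrightarrow> \<sigma> i = \<tau> i\<close> that by auto
    then show ?thesis using that(2) by (auto simp: Q_def)
  qed
  have Q_dec: "Q w j \<sigma>" if "j \<le> k" "Q w k \<sigma>" for w j k \<sigma>
    using that unfolding Q_def by fastforce
  define D where "D j = {w. \<exists>\<sigma>. (\<forall>i. \<sigma> i \<le> b i) \<and> Q w j \<sigma>}" for j
  have D_sets: "D j \<in> sets M" for j
  proof -
    let ?S = "range (\<lambda>(xs::nat list) i. if i < length xs then xs ! i else 0) \<inter> {\<sigma>. \<forall>i. \<sigma> i \<le> b i}"
    have "D j = (\<Union>\<sigma>\<in>?S. {w. Q w j \<sigma>})"
    proof (intro subset_antisym subsetI)
      fix w assume "w \<in> D j"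
      then obtain \<sigma> where \<sigma>: "\<forall>i. \<sigma> i \<le> b i" "Q w j \<sigma>" by (auto simp: D_def)
      define \<tau> where "\<tau> = (\<lambda>(xs::nat list) i. if i < length xs then xs ! i else 0) (map \<sigma> [0..<Suc j])"
      have \<tau>: "\<tau> i = (if i \<le> j then \<sigma> i else 0)" for i
        unfolding \<tau>_def by (auto simp del: upt_Suc simp: less_Suc_eq_le)
      have "Q w j \<tau>" using Q_dep[OF _ \<sigma>(2)] by (simp add: \<tau>)
      moreover have "\<tau> \<in> ?S"
      proof
        show "\<tau> \<in> range (\<lambda>(xs::nat list) i. if i < length xs then xs ! i else 0)"
          unfolding \<tau>_def by (rule rangeI)
        show "\<tau> \<in> {\<sigma>. \<forall>i. \<sigma> i \<le> b i}" using \<sigma>(1) by (simp add: \<tau>)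
      qed
      ultimately show "w \<in> (\<Union>\<sigma>\<in>?S. {w. Q w j \<sigma>})" by blast
    qed (auto simp: D_def)
    moreover have "{w. Q w j \<sigma>} \<in> sets M" for \<sigma>
    proof (cases "(\<Inter>k\<in>{..j}. F k \<sigma>) = {}")
      case False
      then have "{w. Q w j \<sigma>} = (\<Inter>k\<in>{..j}. B k \<sigma>)" by (auto simp: Q_def)
      then show ?thesis using FB(2) by auto
    qed (simp add: Q_def)
    ultimately show ?thesis
      by (auto intro!: sets.countable_UN'')
  qed
  have PD: "P (Suc j) b \<subseteq> D j" for j
  proof
    fix w assume "w \<in> P (Suc j) b"
    then obtain \<sigma> h where \<sigma>: "\<And>i. i < Suc j \<Longrightarrow> \<sigma> i \<le> b i" "\<And>k. (h, w) \<in> F k \<sigma> \<times> B k \<sigma>"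
      unfolding P_def by blast
    have "h \<in> (\<Inter>k\<in>{..j}. F k \<sigma>)" "w \<in> (\<Inter>k\<in>{..j}. B k \<sigma>)"
      using \<sigma>(2) by auto
    then have "Q w j \<sigma>" unfolding Q_def by blast
    then have "Q w j (\<lambda>i. if i \<le> j then \<sigma> i else 0)"
      by (rule Q_dep[rotated]) auto
    moreover have "\<forall>i. (if i \<le> j then \<sigma> i else 0) \<le> b i"
      using \<sigma>(1) by auto
    ultimately show "w \<in> D j"
      unfolding D_def by (intro CollectI exI[of _ "\<lambda>i. if i \<le> j then \<sigma> i else 0"]) simp
  qed
  have "r \<le> emeasure M (W \<inter> D j)" for j
  proof -
    have "r < outer_measure_of M (P (Suc j) b)" by (rule Pb)
    also have "\<dots> \<le> outer_measure_of M (W \<inter> D j)"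
      using PD P_sub W(2) by (intro outer_measure_of_mono) blast
    finally show ?thesis using W(1) D_sets by (simp add: outer_measure_of_eq sets.Int)
  qed
  then have "r \<le> (INF j. emeasure M (W \<inter> D j))"
    by (rule INF_greatest)
  also have "\<dots> = emeasure M (\<Inter>j. W \<inter> D j)"
  proof (rule INF_emeasure_decseq)
    show "range (\<lambda>j. W \<inter> D j) \<subseteq> sets M" using W(1) D_sets by auto
    show "decseq (\<lambda>j. W \<inter> D j)"
      using Q_dec by (auto simp: decseq_def D_def)
    have "emeasure M (W \<inter> D j) \<le> emeasure M W" for j
      using W(1) by (intro emeasure_mono) auto
    then show "emeasure M (W \<inter> D j) \<noteq> \<infinity>" for j
      using fin W(3) by (metis infinity_ennreal_def not_less)
  qed
  finally have "r \<le> emeasure M (\<Inter>j. W \<inter> D j)" .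
  moreover have "(\<Inter>j. W \<inter> D j) \<in> sets M" using W(1) D_sets by auto
  moreover have "(\<Inter>j. W \<inter> D j) \<subseteq> snd ` A"
  proof
    fix w assume w: "w \<in> (\<Inter>j. W \<inter> D j)"
    have "\<exists>\<sigma>. (\<forall>i. \<sigma> i \<le> b i) \<and> (\<forall>k. Q w k \<sigma>)"
      using w by (intro bounded_branch_exists) (auto simp: D_def intro: Q_dep Q_dec)
    then obtain \<sigma> where \<sigma>: "\<And>k. Q w k \<sigma>" by blast
    have "F 0 \<sigma> \<inter> (\<Inter>k\<in>UNIV. F k \<sigma>) \<noteq> {}"
    proof (rule compact_imp_fip_image)
      fix I :: "nat set" assume "finite I"
      then obtain j where "I \<subseteq> {..j}" using finite_nat_iff_bounded_le by blast
      then show "F 0 \<sigma> \<inter> (\<Inter>k\<in>I. F k \<sigma>) \<noteq> {}"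
        using \<sigma>[of j] unfolding Q_def by fastforce
    qed (use FB in \<open>auto intro: compact_imp_closed\<close>)
    then obtain h where "\<And>k. h \<in> F k \<sigma>" by blast
    moreover have "\<And>k. w \<in> B k \<sigma>" using \<sigma> by (auto simp: Q_def)
    ultimately have "(h, w) \<in> A" unfolding A_eq by blast
    then show "w \<in> snd ` A" by force
  qed
  ultimately show ?thesis by blast
qed

lemma suslin_projection:
  fixes A :: "('h::t2_space \<times> 'w) set"
  assumes A: "suslin M A" and "finite_measure M"
  shows "snd ` A \<in> sets (completion M)"
proof -
  interpret finite_measure M by fact
  have sub: "snd ` A \<subseteq> space M"
  proof -
    obtain F B where "suslin_scheme M F B" "A = (\<Union>\<sigma>. \<Inter>k. F k \<sigma> \<times> B k \<sigma>)"
      using A unfolding suslin_def scheme_set_def by blast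
    then show ?thesis using sets.sets_into_space[OF suslin_schemeD(2)] by fastforce
  qed
  obtain W where W: "W \<in> sets M" "snd ` A \<subseteq> W" "outer_measure_of M (snd ` A) = emeasure M W"
    using outer_measure_of_attain[OF sub] by blast
  let ?D = "{D\<in>sets M. D \<subseteq> snd ` A}"
  have W_SUP: "emeasure M W = (SUP D\<in>?D. emeasure M D)"
  proof (rule antisym)
    show "emeasure M W \<le> (SUP D\<in>?D. emeasure M D)"
    proof (rule dense_le)
      fix r assume "r < emeasure M W"
      then have "\<exists>D\<in>sets M. D \<subseteq> snd ` A \<and> r \<le> emeasure M D"
        using suslin_projection_inner[OF A, of r] W(3) emeasure_finite[of W] by (simp add: less_top[symmetric])
      then show "r \<le> (SUP D\<in>?D. emeasure M D)" by (auto intro: SUP_upper2)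
    qed
    show "(SUP D\<in>?D. emeasure M D) \<le> emeasure M W"
      using W by (auto intro!: SUP_least emeasure_mono)
  qed
  obtain g :: "nat \<Rightarrow> ennreal" where g: "range g \<subseteq> emeasure M ` ?D"
    and g_SUP: "emeasure M W = (SUP n. g n)"
    using ennreal_SUP_countable_SUP[of ?D "emeasure M"] W_SUP by auto
  have "\<forall>n. \<exists>D. D \<in> ?D \<and> g n = emeasure M D"
    using g by (auto simp: image_subset_iff image_iff)
  then obtain D where D: "\<And>n. D n \<in> sets M" "\<And>n. D n \<subseteq> snd ` A" "\<And>n. g n = emeasure M (D n)"
    by (drule_tac choice) blast
  have "emeasure M (\<Union>n. D n) = emeasure M W"
  proof (rule antisym)
    show "emeasure M W \<le> emeasure M (\<Union>n. D n)"
      unfolding g_SUP D(3) using D(1) by (intro SUP_least emeasure_mono) auto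
    show "emeasure M (\<Union>n. D n) \<le> emeasure M W"
      using D(2) W by (intro emeasure_mono) blast+
  qed
  moreover have UD: "(\<Union>n. D n) \<in> sets M" using D(1) by auto
  ultimately have "emeasure (completion M) (\<Union>n. D n) = emeasure (completion M) W"
    using W(1) by simp
  moreover have "emeasure (completion M) (\<Union>n. D n) < \<infinity>"
    using UD emeasure_finite[of "\<Union>n. D n"] by (simp add: less_top[symmetric])
  moreover have "(\<Union>n. D n) \<subseteq> snd ` A" using D(2) by (rule UN_least)
  ultimately show ?thesis
    by (rule completion.complete_sets_sandwich[OF sets_completionI_sets[OF UD]
          sets_completionI_sets[OF W(1)] _ W(2), rotated 1])
qed

section \<open>Measurable enumeration of countable sections\<close>

lemma open_eq_UN_compact:
  fixes U :: "'h::{t2_space, second_countable_topology} set"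
  assumes lc: "locally compact (UNIV :: 'h set)" and U: "open U"
  shows "\<exists>C::nat \<Rightarrow> 'h set. (\<forall>n. compact (C n)) \<and> U = (\<Union>n. C n)"
proof -
  obtain \<B> :: "'h set set" where \<B>: "countable \<B>" "topological_basis \<B>"
    using ex_countable_basis by blast
  define \<C> where "\<C> = {b\<in>\<B>. \<exists>v. compact v \<and> b \<subseteq> v \<and> v \<subseteq> U}"
  define v where "v b = (SOME v. compact v \<and> b \<subseteq> v \<and> v \<subseteq> U)" for b
  have v: "compact (v b) \<and> b \<subseteq> v b \<and> v b \<subseteq> U" if "b \<in> \<C>" for b
    unfolding v_def by (rule someI_ex) (use that in \<open>simp add: \<C>_def\<close>)
  have U_eq: "U = (\<Union>b\<in>\<C>. v b)"
  proof (intro subset_antisym subsetI)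
    fix x assume x: "x \<in> U"
    obtain u w where uw: "openin (top_of_set UNIV) u" "compact w" "x \<in> u" "u \<subseteq> w" "w \<subseteq> U"
      using lc U x by (force elim!: locallyE[of compact UNIV U x])
    then obtain b where "b \<in> \<B>" "x \<in> b" "b \<subseteq> u"
      using topological_basisE[OF \<B>(2), of u x] by auto
    with uw have "b \<in> \<C>" unfolding \<C>_def by blast
    with v \<open>x \<in> b\<close> show "x \<in> (\<Union>b\<in>\<C>. v b)" by blast
  qed (use v in blast)
  have "countable (insert {} (v ` \<C>))" using \<B>(1) by (auto simp: \<C>_def)
  then have "range (from_nat_into (insert {} (v ` \<C>))) = insert {} (v ` \<C>)"
    by (intro range_from_nat_into) auto
  moreover have "\<Union>(insert {} (v ` \<C>)) = U" using U_eq by auto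
  moreover have "compact w" if "w \<in> insert {} (v ` \<C>)" for w using that v by auto
  ultimately show ?thesis
    by (intro exI[of _ "from_nat_into (insert {} (v ` \<C>))"]) (metis rangeI)
qed

lemma measurable_projection:
  fixes A :: "('h::{t2_space, second_countable_topology} \<times> 'w) set"
  assumes lc: "locally compact (UNIV :: 'h set)" and M: "finite_measure M"
    and A: "A \<in> sets (borel \<Otimes>\<^sub>M M)"
  shows "snd ` A \<in> sets (completion M)"
proof -
  let ?\<Omega> = "(UNIV :: 'h set) \<times> space M"
  obtain K :: "nat \<Rightarrow> 'h set" where K: "\<And>n. compact (K n)" "UNIV = (\<Union>n. K n)"
    using open_eq_UN_compact[OF lc open_UNIV] by blast
  have closed: "suslin M (F \<times> D)" if "closed F" "D \<in> sets M" for F :: "'h set" and D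
  proof -
    have "F \<times> D = (\<Union>n. (K n \<inter> F) \<times> D)" using K(2) by auto
    then show ?thesis
      using that K(1) by (auto intro!: suslin_UN suslin_Times compact_Int_closed)
  qed
  have open': "suslin M (U \<times> D)" if U: "open U" and "D \<in> sets M" for U :: "'h set" and D
  proof -
    obtain C where C: "\<And>n::nat. compact (C n)" "U = (\<Union>n. C n)"
      using open_eq_UN_compact[OF lc U] by blast
    have "U \<times> D = (\<Union>n. C n \<times> D)" using C(2) by auto
    then show ?thesis
      using that C(1) by (auto intro!: suslin_UN suslin_Times)
  qed
  have rect: "suslin M (a \<times> D) \<and> suslin M (?\<Omega> - a \<times> D)" if a: "a \<in> sets borel" and D: "D \<in> sets M"
    for a :: "'h set" and D
  proof -
    have "suslin M (a \<times> D) \<and> suslin M ((UNIV - a) \<times> D)"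
      using a[unfolded sets_borel]
    proof (induction rule: sigma_sets.induct)
      case (Basic a)
      then show ?case using open' closed D by (simp add: closed_def Compl_eq_Diff_UNIV[symmetric])
    next
      case Empty
      then show ?case using closed[OF closed_UNIV D] closed[OF closed_empty D] by simp
    next
      case (Compl a)
      then show ?case by (simp add: double_diff)
    next
      case (Union a)
      have "suslin M (\<Union>i. a i \<times> D)" using Union by (intro suslin_UN) simp
      moreover have "suslin M (\<Inter>i. (UNIV - a i) \<times> D)" using Union by (intro suslin_INT) simp
      moreover have "(\<Union>i. a i \<times> D) = (\<Union>i. a i) \<times> D"
        "(\<Inter>i. (UNIV - a i) \<times> D) = (UNIV - (\<Union>i. a i)) \<times> D" by auto
      ultimately show ?case by simp
    qed
    moreover have "?\<Omega> - a \<times> D = (UNIV - a) \<times> D \<union> UNIV \<times> (space M - D)"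
      using sets.sets_into_space[OF D] by auto
    moreover have "suslin M ((UNIV :: 'h set) \<times> (space M - D))"
      using closed[of UNIV "space M - D"] D by auto
    ultimately show ?thesis by (auto intro: suslin_Un)
  qed
  have "suslin M A \<and> suslin M (?\<Omega> - A)"
    using A[unfolded sets_pair_measure space_borel]
  proof (induction rule: sigma_sets.induct)
    case (Basic a)
    then show ?case using rect by auto
  next
    case Empty
    then show ?case using rect[of "{}" "{}"] by simp
  next
    case (Compl a)
    moreover have "?\<Omega> - (?\<Omega> - a) = a"
      using Compl.hyps by (intro double_diff) (auto dest: sigma_sets_into_sp[rotated] sets.sets_into_space)
    ultimately show ?case by simp
  next
    case (Union a)
    have "suslin M (\<Union>i. a i)" using Union by (intro suslin_UN) simp
    moreover have "suslin M (\<Inter>i. ?\<Omega> - a i)" using Union by (intro suslin_INT) simp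
    moreover have "(\<Inter>i. ?\<Omega> - a i) = ?\<Omega> - (\<Union>i. a i)" by auto
    ultimately show ?case by simp
  qed
  then show ?thesis using suslin_projection M by blast
qed

lemma small_disjoint_cover:
  fixes U :: "'g::{topological_group_add, second_countable_topology} set"
  assumes U: "open U" "0 \<in> U"
  obtains D :: "nat \<Rightarrow> 'g set" where
    "\<And>n. D n \<in> sets borel" "disjoint_family D" "(\<Union>n. D n) = UNIV"
    "\<And>n h h'. h \<in> D n \<Longrightarrow> h' \<in> D n \<Longrightarrow> h - h' \<in> U"
    "\<And>K. compact K \<Longrightarrow> \<exists>n. \<forall>i\<ge>n. D i \<inter> K = {}"
proof -
  have "open ((\<lambda>p::'g \<times> 'g. fst p - snd p) -` U)"
    using U(1) by (intro open_vimage continuous_intros)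
  then obtain V1 V2 where V12: "open V1" "open V2" "(0, 0) \<in> V1 \<times> V2"
    "V1 \<times> V2 \<subseteq> (\<lambda>p::'g \<times> 'g. fst p - snd p) -` U"
    by (rule open_prod_elim[of _ "(0, 0)"]) (use U(2) in auto)
  define V where "V = V1 \<inter> V2"
  have V: "open V" "0 \<in> V" "\<And>v w. v \<in> V \<Longrightarrow> w \<in> V \<Longrightarrow> v - w \<in> U"
    using V12 by (auto simp: V_def)
  define W where "W x = (\<lambda>y. y - x) -` V" for x
  have W_open: "open (W x)" for x
    unfolding W_def using V(1) by (intro open_vimage continuous_intros)
  obtain \<F> where \<F>: "\<F> \<subseteq> range W" "countable \<F>" "\<Union>\<F> = \<Union>(range W)"
    using Lindelof[of "range W"] W_open by blast
  have W_self: "x \<in> W x" for x by (simp add: W_def V)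
  then have cover: "\<Union>\<F> = UNIV" using \<F>(3) by auto
  then have "\<F> \<noteq> {}" by auto
  define w where "w = from_nat_into \<F>"
  have w: "range w = \<F>" unfolding w_def using \<open>\<F> \<noteq> {}\<close> \<F>(2) by (rule range_from_nat_into)
  have wW: "\<exists>x. w n = W x" for n
  proof -
    have "w n \<in> \<F>" unfolding w[symmetric] by (rule rangeI)
    then have "w n \<in> range W" using \<F>(1) by (rule subsetD[rotated])
    then show ?thesis by (rule rangeE) (rule exI)
  qed
  then have w_open: "open (w n)" for n using W_open by metis
  have w_diff: "h - h' \<in> U" if "h \<in> w n" "h' \<in> w n" for n h h'
  proof -
    obtain x where "w n = W x" using wW by blast
    then have "(h - x) - (h' - x) \<in> U" using that V(3) by (simp add: W_def)
    moreover have "(h - x) - (h' - x) = h - h'"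
      by (simp add: algebra_simps)
    ultimately show ?thesis by simp
  qed
  show thesis
  proof (rule that[of "disjointed w"])
    show "disjointed w n \<in> sets borel" for n
      unfolding disjointed_def using w_open by (auto intro!: sets.Diff sets.finite_UN)
    show "disjoint_family (disjointed w)" by (rule disjoint_family_disjointed)
    show "(\<Union>n. disjointed w n) = UNIV" using UN_disjointed_eq[of w] w cover by simp
    show "h - h' \<in> U" if "h \<in> disjointed w n" "h' \<in> disjointed w n" for n h h'
      using that disjointed_subset[of w n] w_diff by blast
    show "\<exists>n. \<forall>i\<ge>n. disjointed w i \<inter> K = {}" if K: "compact K" for K
    proof -
      obtain I where I: "finite I" "K \<subseteq> (\<Union>n\<in>I. w n)"
        using compactE_image[OF K, of UNIV w] w_open cover w by auto
      then obtain n where n: "I \<subseteq> {..<n}" using finite_nat_iff_bounded by blast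
      have "disjointed w i \<inter> K = {}" if "n \<le> i" for i
        using I(2) n that unfolding disjointed_def by fastforce
      then show ?thesis by blast
    qed
  qed
qed

locale countable_sections =
  fixes M :: "'w measure" and B :: "('h::{t2_space, second_countable_topology} \<times> 'w) set"
    and D :: "nat \<Rightarrow> 'h set" and h0 :: 'h
  assumes lc: "locally compact (UNIV :: 'h set)" and M: "finite_measure M"
    and B: "B \<in> sets (borel \<Otimes>\<^sub>M M)" and D: "\<And>n. D n \<in> sets borel"
    and disj: "disjoint_family D" and cover: "(\<Union>n. D n) = UNIV"
    and unique: "\<And>n h h' w. h \<in> D n \<Longrightarrow> h' \<in> D n \<Longrightarrow> (h, w) \<in> B \<Longrightarrow> (h', w) \<in> B \<Longrightarrow> h = h'"
begin

definition "sdom n = snd ` (B \<inter> D n \<times> space M)"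

definition "sel n w = (if w \<in> sdom n then THE h. h \<in> D n \<and> (h, w) \<in> B else h0)"

lemma sel_eq: "h \<in> D n \<Longrightarrow> (h, w) \<in> B \<Longrightarrow> w \<in> sdom n \<and> sel n w = h"
proof -
  assume *: "h \<in> D n" "(h, w) \<in> B"
  moreover have "w \<in> space M"
    using *(2) sets.sets_into_space[OF B] by (auto simp: space_pair_measure)
  ultimately have "w \<in> sdom n" unfolding sdom_def by (auto intro!: image_eqI[of _ _ "(h, w)"])
  moreover have "(THE h. h \<in> D n \<and> (h, w) \<in> B) = h"
    using * unique by (intro the_equality) blast+
  ultimately show ?thesis by (simp add: sel_def)
qed

lemma sel_mem: "w \<in> sdom n \<Longrightarrow> sel n w \<in> D n \<and> (sel n w, w) \<in> B"
  using sel_eq unfolding sdom_def by fastforce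

lemma sel_bij: "bij_betw (\<lambda>n. sel n w) {n. w \<in> sdom n} {h. (h, w) \<in> B}"
proof (rule bij_betwI')
  fix n m assume "n \<in> {n. w \<in> sdom n}" "m \<in> {n. w \<in> sdom n}"
  then show "(sel n w = sel m w) = (n = m)"
    using sel_mem[of w n] sel_mem[of w m] disj
    unfolding disjoint_family_on_def by (metis Int_iff UNIV_I empty_iff mem_Collect_eq)
next
  fix h assume h: "h \<in> {h. (h, w) \<in> B}"
  moreover obtain n where "h \<in> D n" using cover by blast
  ultimately show "\<exists>n\<in>{n. w \<in> sdom n}. h = sel n w" using sel_eq by blast
qed (use sel_mem in blast)

lemma sum_sections:
  fixes F :: "'h \<Rightarrow> ennreal"
  shows "(\<integral>\<^sup>+h. F h \<partial>count_space {h. (h, w) \<in> B}) = (\<Sum>n. indicator (sdom n) w * F (sel n w))"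
proof -
  have "(\<integral>\<^sup>+h. F h \<partial>count_space {h. (h, w) \<in> B}) = (\<integral>\<^sup>+n. F (sel n w) \<partial>count_space {n. w \<in> sdom n})"
    by (rule nn_integral_bij_count_space[OF sel_bij, symmetric])
  also have "\<dots> = (\<integral>\<^sup>+n. F (sel n w) * indicator {n. w \<in> sdom n} n \<partial>count_space UNIV)"
    by (rule nn_integral_count_space_indicator) simp
  also have "\<dots> = (\<Sum>n. F (sel n w) * indicator {n. w \<in> sdom n} n)"
    by (rule nn_integral_count_space_nat)
  also have "\<dots> = (\<Sum>n. indicator (sdom n) w * F (sel n w))"
    by (intro suminf_cong) (simp add: indicator_def)
  finally show ?thesis .
qed

lemma projection_sets: "X \<in> sets borel \<Longrightarrow> snd ` (B \<inter> (D n \<inter> X) \<times> space M) \<in> sets (completion M)"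
  using B D by (intro measurable_projection[OF lc M]) auto

lemma sdom_sets[measurable]: "sdom n \<in> sets (completion M)"
  using projection_sets[of UNIV n] by (simp add: sdom_def)

lemma sel_measurable[measurable]: "sel n \<in> measurable (completion M) borel"
proof (rule borel_measurableI)
  fix S :: "'h set" assume "open S"
  have "sel n -` S \<inter> space M = snd ` (B \<inter> (D n \<inter> S) \<times> space M) \<union> (if h0 \<in> S then space M - sdom n else {})"
  proof (intro subset_antisym subsetI)
    fix w assume w: "w \<in> sel n -` S \<inter> space M"
    show "w \<in> snd ` (B \<inter> (D n \<inter> S) \<times> space M) \<union> (if h0 \<in> S then space M - sdom n else {})"
    proof (cases "w \<in> sdom n")
      case True
      then show ?thesis using sel_mem[OF True] w by (auto intro!: image_eqI[of _ _ "(sel n w, w)"])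
    next
      case False
      then show ?thesis using w by (auto simp: sel_def)
    qed
  next
    fix w assume "w \<in> snd ` (B \<inter> (D n \<inter> S) \<times> space M) \<union> (if h0 \<in> S then space M - sdom n else {})"
    then consider h where "(h, w) \<in> B" "h \<in> D n" "h \<in> S" "w \<in> space M"
      | "h0 \<in> S" "w \<in> space M" "w \<notin> sdom n"
      by (auto split: if_splits)
    then show "w \<in> sel n -` S \<inter> space M"
    proof cases
      case 1
      then show ?thesis using sel_eq[of h n w] by simp
    qed (simp add: sel_def)
  qed
  then show "sel n -` S \<inter> space (completion M) \<in> sets (completion M)"
    using projection_sets[of S n] sdom_sets[of n] \<open>open S\<close> sets.compl_sets[OF sdom_sets, of n] by auto
qed

end

section \<open>Haar measures on closed subgroups and uniqueness of transverse measures\<close>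

lemma sets_pair_restrict_space:
  assumes H: "H \<in> sets M" and E: "E \<in> sets (restrict_space M H \<Otimes>\<^sub>M N)"
  shows "E \<in> sets (M \<Otimes>\<^sub>M N)"
  using E[unfolded sets_pair_measure]
proof (induction rule: sigma_sets.induct)
  case (Basic a)
  then show ?case using H by (auto simp: sets_restrict_space_iff)
next
  case (Compl a)
  have "space (restrict_space M H) \<times> space N \<in> sets (M \<Otimes>\<^sub>M N)"
    using H sets.sets_into_space[OF H] by (intro pair_measureI) (auto simp: space_restrict_space Int_absorb2)
  with Compl show ?case by (intro sets.Diff)
next
  case (Union a)
  then show ?case by (intro sets.countable_UN') auto
qed simp

lemma nn_integral_completion_distr:
  fixes g :: "'a \<Rightarrow> ennreal"
  assumes \<phi>: "\<phi> \<in> measurable M M" "distr M M \<phi> = M" and g: "g \<in> borel_measurable (completion M)"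
  shows "(\<integral>\<^sup>+x. g (\<phi> x) \<partial>M) = (\<integral>\<^sup>+x. g x \<partial>M)"
proof -
  obtain g' where g': "g' \<in> borel_measurable M" "AE x in M. g x = g' x"
    using completion_ex_borel_measurable[OF g] by blast
  have "AE x in distr M M \<phi>. g x = g' x" unfolding \<phi>(2) by (rule g'(2))
  then have "AE x in M. g (\<phi> x) = g' (\<phi> x)" by (rule AE_distrD[OF \<phi>(1)])
  then have "(\<integral>\<^sup>+x. g (\<phi> x) \<partial>M) = (\<integral>\<^sup>+x. g' (\<phi> x) \<partial>M)" by (rule nn_integral_cong_AE)
  also have "\<dots> = (\<integral>\<^sup>+x. g' x \<partial>distr M M \<phi>)" using \<phi>(1) g'(1) by (simp add: nn_integral_distr)
  also have "\<dots> = (\<integral>\<^sup>+x. g x \<partial>M)" unfolding \<phi>(2) using g'(2) by (intro nn_integral_cong_AE) auto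
  finally show ?thesis .
qed

lemma finite_measure_completion: "finite_measure M \<Longrightarrow> finite_measure (completion M)"
  by (rule finite_measureI) (simp add: finite_measure.emeasure_finite)

lemma closed_subgroupD:
  assumes "closed_subgroup H"
  shows "closed H" "0 \<in> H" "g \<in> H \<Longrightarrow> h \<in> H \<Longrightarrow> g + h \<in> H" "g \<in> H \<Longrightarrow> - g \<in> H" "H \<in> sets borel"
    "g \<in> H \<Longrightarrow> h \<in> H \<Longrightarrow> g - h \<in> H"
  using assms unfolding closed_subgroup_def by (auto simp del: add_uminus_conv_diff simp add: diff_conv_add_uminus)

lemma subgroup_add_measurable:
  fixes H :: "'g::{topological_group_add, second_countable_topology} set"
  assumes "closed_subgroup H"
    and f: "f \<in> measurable M (restrict_space borel H)" and g: "g \<in> measurable M (restrict_space borel H)"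
  shows "(\<lambda>x. f x + g x) \<in> measurable M (restrict_space borel H)"
  using assms measurable_space[OF f] measurable_space[OF g]
  by (auto simp: measurable_restrict_space2_iff space_restrict_space dest: closed_subgroupD)

lemma subgroup_uminus_measurable:
  fixes H :: "'g::{topological_group_add, second_countable_topology} set"
  assumes "closed_subgroup H" and f: "f \<in> measurable M (restrict_space borel H)"
  shows "(\<lambda>x. - f x) \<in> measurable M (restrict_space borel H)"
proof -
  have "(uminus :: 'g \<Rightarrow> 'g) \<in> borel_measurable borel"
    by (intro borel_measurable_continuous_onI continuous_intros)
  then show ?thesis
    using assms measurable_space[OF f]
    by (auto simp: measurable_restrict_space2_iff space_restrict_space dest: closed_subgroupD)
qed

locale haar_subgroup =
  fixes H :: "'g::{topological_group_add, t2_space, second_countable_topology} set" and m :: "'g measure"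
  assumes lc: "locally compact (UNIV :: 'g set)"
    and H: "closed_subgroup H" and haar: "haar_measure H m"
begin

lemma sets_m[measurable_cong]: "sets m = sets (restrict_space borel H)"
  using haar by (simp add: haar_measure_def)

lemma space_m: "space m = H"
  using sets_eq_imp_space_eq[OF sets_m] by (simp add: space_restrict_space)

lemmas add_meas[measurable (raw)] = subgroup_add_measurable[OF H]
lemmas uminus_meas[measurable (raw)] = subgroup_uminus_measurable[OF H]

lemma compact_sets_m: "compact K \<Longrightarrow> K \<subseteq> H \<Longrightarrow> K \<in> sets m"
  using closed_subgroupD(5)[OF H] by (auto simp: sets_m sets_restrict_space_iff compact_imp_closed)

lemma ex_compact_exhaustion: "\<exists>K::nat \<Rightarrow> 'g set. (\<forall>n. compact (K n)) \<and> (\<forall>n. K n \<subseteq> H) \<and> H = (\<Union>n. K n)"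
proof -
  obtain K :: "nat \<Rightarrow> 'g set" where K: "\<And>n. compact (K n)" "UNIV = (\<Union>n. K n)"
    using open_eq_UN_compact[OF lc open_UNIV] by blast
  have "H = (\<Union>n. K n \<inter> H)" using K(2) by auto
  then show ?thesis
    using K(1) closed_subgroupD(1)[OF H] by (intro exI[of _ "\<lambda>n. K n \<inter> H"]) auto
qed

lemma sigma_finite_m: "sigma_finite_measure m"
proof -
  obtain K :: "nat \<Rightarrow> 'g set" where K: "\<And>n. compact (K n)" "\<And>n. K n \<subseteq> H" "H = (\<Union>n. K n)"
    using ex_compact_exhaustion by metis
  show ?thesis
  proof
    show "\<exists>A. countable A \<and> A \<subseteq> sets m \<and> \<Union>A = space m \<and> (\<forall>a\<in>A. emeasure m a \<noteq> \<infinity>)"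
      using K haar compact_sets_m unfolding haar_measure_def space_m
      by (intro exI[of _ "range K"]) (auto simp: less_top[symmetric])
  qed
qed

lemma ex_symmetric_compact:
  "\<exists>C. compact C \<and> C \<subseteq> H \<and> (\<forall>g. - g \<in> C \<longleftrightarrow> g \<in> C) \<and> emeasure m C \<noteq> 0 \<and> emeasure m C \<noteq> \<infinity>"
proof -
  obtain K :: "nat \<Rightarrow> 'g set" where K: "\<And>n. compact (K n)" "\<And>n. K n \<subseteq> H" "H = (\<Union>n. K n)"
    using ex_compact_exhaustion by metis
  have "\<exists>n. emeasure m (K n) \<noteq> 0"
  proof (rule ccontr)
    assume "\<nexists>n. emeasure m (K n) \<noteq> 0"
    then have "(\<Union>n. K n) \<in> null_sets m"
      using K compact_sets_m by (intro null_sets_UN) auto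
    then have "emeasure m H = 0" unfolding K(3) by (rule null_setsD1)
    then show False using haar unfolding haar_measure_def by blast
  qed
  then obtain n where n: "emeasure m (K n) \<noteq> 0" by blast
  let ?C = "K n \<union> uminus ` K n"
  have C: "compact ?C"
    using K(1) by (intro compact_Un compact_continuous_image continuous_intros)
  have CH: "?C \<subseteq> H" using K(2) closed_subgroupD(4)[OF H] by blast
  have "emeasure m (K n) \<le> emeasure m ?C"
    using C CH by (intro emeasure_mono compact_sets_m) auto
  then have "emeasure m ?C \<noteq> 0" using n by auto
  moreover have "emeasure m ?C \<noteq> \<infinity>"
    using C CH haar by (auto simp: haar_measure_def less_top[symmetric])
  moreover have "\<forall>g. - g \<in> ?C \<longleftrightarrow> g \<in> ?C" by (force simp: image_iff)
  ultimately show ?thesis using C CH by blast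
qed

lemma nn_integral_left:
  assumes "h \<in> H" and [measurable]: "f \<in> borel_measurable m"
  shows "(\<integral>\<^sup>+x. f (h + x) \<partial>m) = (\<integral>\<^sup>+x. f x \<partial>m)"
proof -
  have "(\<lambda>x. h + x) \<in> measurable m m"
    using assms(1) by (auto simp: measurable_cong_sets[OF sets_m sets_m] space_restrict_space intro!: add_meas)
  then have "(\<integral>\<^sup>+x. f (h + x) \<partial>m) = (\<integral>\<^sup>+x. f x \<partial>distr m m (\<lambda>x. h + x))"
    by (simp add: nn_integral_distr)
  then show ?thesis using haar assms(1) by (simp add: haar_measure_def)
qed

lemma nn_integral_right:
  assumes "unimodular H" "h \<in> H" and [measurable]: "f \<in> borel_measurable m"
  shows "(\<integral>\<^sup>+x. f (x + h) \<partial>m) = (\<integral>\<^sup>+x. f x \<partial>m)"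
proof -
  have "(\<lambda>x. x + h) \<in> measurable m m"
    using assms(2) by (auto simp: measurable_cong_sets[OF sets_m sets_m] space_restrict_space intro!: add_meas)
  then have "(\<integral>\<^sup>+x. f (x + h) \<partial>m) = (\<integral>\<^sup>+x. f x \<partial>distr m m (\<lambda>x. x + h))"
    by (simp add: nn_integral_distr)
  then show ?thesis using haar assms(1,2) by (simp add: unimodular_def)
qed

lemma transverse_measure_unique:
  assumes \<nu>: "is_transverse_measure H m act T \<mu> \<nu>" and \<nu>': "is_transverse_measure H m act T \<mu> \<nu>'"
  shows "\<nu> = \<nu>'"
proof (rule measure_eqI)
  show "sets \<nu> = sets \<nu>'" using \<nu> \<nu>' by (simp add: is_transverse_measure_def)
  fix A assume "A \<in> sets \<nu>"
  then have A: "A \<in> sets (restrict_space borel T)" using \<nu> by (simp add: is_transverse_measure_def)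
  obtain C where C: "compact C" "C \<subseteq> H" "emeasure m C \<noteq> 0" "emeasure m C \<noteq> \<infinity>"
    using ex_symmetric_compact by blast
  have C_sets: "C \<in> sets (restrict_space borel H)"
    using compact_sets_m C sets_m by simp
  define f :: "'g \<times> 'a \<Rightarrow> real" where "f p = indicator C (fst p) * indicator A (snd p)" for p
  have [measurable]: "f \<in> borel_measurable (restrict_space borel H \<Otimes>\<^sub>M restrict_space borel T)"
    unfolding f_def using A C_sets by measurable
  have f: "f \<in> borel_measurable (restrict_space borel H \<Otimes>\<^sub>M restrict_space borel T) \<and>
     (\<forall>p\<in>H \<times> T. 0 \<le> f p) \<and> bounded (f ` (H \<times> T))"
    by (auto simp: f_def bounded_iff intro!: exI[of _ 1] split: split_indicator)
  have eq: "(\<integral>\<^sup>+ h. (\<integral>\<^sup>+ t. ennreal (f (h, t)) \<partial>\<nu>) \<partial>m) = (\<integral>\<^sup>+ h. (\<integral>\<^sup>+ t. ennreal (f (h, t)) \<partial>\<nu>') \<partial>m)"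
    using \<nu>[unfolded is_transverse_measure_def, THEN conjunct2, rule_format, OF f]
      \<nu>'[unfolded is_transverse_measure_def, THEN conjunct2, rule_format, OF f] by simp
  have "(\<integral>\<^sup>+ h. (\<integral>\<^sup>+ t. ennreal (f (h, t)) \<partial>\<rho>) \<partial>m) = emeasure m C * emeasure \<rho> A"
    if "sets \<rho> = sets (restrict_space borel T)" for \<rho>
  proof -
    have "(\<integral>\<^sup>+ h. (\<integral>\<^sup>+ t. ennreal (f (h, t)) \<partial>\<rho>) \<partial>m) = (\<integral>\<^sup>+ h. (\<integral>\<^sup>+ t. indicator C h * indicator A t \<partial>\<rho>) \<partial>m)"
      by (intro nn_integral_cong) (auto simp: f_def split: split_indicator)
    also have "\<dots> = (\<integral>\<^sup>+ h. indicator C h * emeasure \<rho> A \<partial>m)"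
      using A that by (intro nn_integral_cong) (simp add: nn_integral_cmult)
    also have "\<dots> = emeasure m C * emeasure \<rho> A"
      using compact_sets_m[OF C(1,2)] by (simp add: nn_integral_multc)
    finally show ?thesis .
  qed
  then have "emeasure m C * emeasure \<nu> A = emeasure m C * emeasure \<nu>' A"
    using eq \<nu> \<nu>' by (simp add: is_transverse_measure_def)
  then show "emeasure \<nu> A = emeasure \<nu>' A"
    using C(3,4) by (simp add: ennreal_mult_cancel_left)
qed

lemma transverse_measure_eq:
  "is_transverse_measure H m act T \<mu> \<nu> \<Longrightarrow> transverse_measure H m act T \<mu> = \<nu>"
  unfolding transverse_measure_def by (rule the_equality) (auto intro: transverse_measure_unique)

end

section \<open>Existence of transverse measures\<close>

locale separated_action =
  fixes H :: "'g::{topological_group_add, t2_space, second_countable_topology} set"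
    and act :: "'g \<Rightarrow> 'x::polish_space \<Rightarrow> 'x" and S T :: "'x set" and \<mu> :: "'x measure"
  assumes lc: "locally compact (UNIV :: 'g set)" and H: "closed_subgroup H"
    and action: "borel_action H S act" and T_sets: "T \<in> sets (restrict_space borel S)"
    and sep: "separated H act T"
    and sets_mu[measurable_cong]: "sets \<mu> = sets (restrict_space borel S)" and fin: "finite_measure \<mu>"
begin

abbreviation "R\<^sub>H \<equiv> restrict_space borel H"
abbreviation "R\<^sub>T \<equiv> restrict_space borel T"

lemmas add_meas[measurable (raw)] = subgroup_add_measurable[OF H]
lemmas uminus_meas[measurable (raw)] = subgroup_uminus_measurable[OF H]

lemma S_borel: "S \<in> sets borel"
  using action by (simp add: borel_action_def)

lemma space_mu: "space \<mu> = S"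
  using sets_eq_imp_space_eq[OF sets_mu] by (simp add: space_restrict_space)

lemma T_subset: "T \<subseteq> S"
  using T_sets S_borel by (auto simp: sets_restrict_space_iff)

lemma act_add: "g \<in> H \<Longrightarrow> h \<in> H \<Longrightarrow> s \<in> S \<Longrightarrow> act (g + h) s = act g (act h s)"
  using action by (simp add: borel_action_def)

lemma act_pair_measurable: "(\<lambda>(h, s). act h s) \<in> measurable (R\<^sub>H \<Otimes>\<^sub>M \<mu>) \<mu>"
proof -
  have "(\<lambda>(h, s). act h s) \<in> measurable (R\<^sub>H \<Otimes>\<^sub>M restrict_space borel S) (restrict_space borel S)"
    using action by (simp add: borel_action_def)
  then show ?thesis
    using measurable_cong_sets[OF sets_pair_measure_cong[OF refl sets_mu] sets_mu] by blast
qed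

lemma act_measurable[measurable (raw)]:
  assumes "f \<in> measurable M R\<^sub>H" "g \<in> measurable M \<mu>"
  shows "(\<lambda>x. act (f x) (g x)) \<in> measurable M \<mu>"
  using measurable_compose[OF measurable_Pair[OF assms] act_pair_measurable] by simp

lemma act_fixed_measurable: "h \<in> H \<Longrightarrow> act h \<in> measurable \<mu> \<mu>"
  using act_measurable[of "\<lambda>_. h" \<mu> "\<lambda>x. x"] by (simp add: space_restrict_space)

lemma measurable_R\<^sub>T: "f \<in> measurable M \<mu> \<Longrightarrow> (\<And>x. x \<in> space M \<Longrightarrow> f x \<in> T) \<Longrightarrow> f \<in> measurable M R\<^sub>T"
  by (auto simp: measurable_restrict_space2_iff measurable_cong_sets[OF refl sets_mu])

lemma T_nonempty: "T \<noteq> {}"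
  using sep by (auto simp: separated_def)

definition "B = {p. fst p \<in> H \<and> snd p \<in> S \<and> act (fst p) (snd p) \<in> T}"

lemma B_iff: "(h, s) \<in> B \<longleftrightarrow> h \<in> H \<and> s \<in> S \<and> act h s \<in> T"
  by (simp add: B_def)

lemma B_sets: "B \<in> sets (borel \<Otimes>\<^sub>M \<mu>)"
proof (rule sets_pair_restrict_space[OF closed_subgroupD(5)[OF H]])
  have "T \<in> sets \<mu>" using T_sets sets_mu by simp
  then have "(\<lambda>(h, s). act h s) -` T \<inter> space (R\<^sub>H \<Otimes>\<^sub>M \<mu>) \<in> sets (R\<^sub>H \<Otimes>\<^sub>M \<mu>)"
    by (rule measurable_sets[OF act_pair_measurable])
  also have "(\<lambda>(h, s). act h s) -` T \<inter> space (R\<^sub>H \<Otimes>\<^sub>M \<mu>) = B"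
    by (auto simp: B_def space_pair_measure space_restrict_space space_mu)
  finally show "B \<in> sets (R\<^sub>H \<Otimes>\<^sub>M \<mu>)" .
qed

lemma hitting_set_eq: "s \<in> S \<Longrightarrow> hitting_set H act T s = {h. (h, s) \<in> B}"
  by (auto simp: hitting_set_def B_iff)

definition enumeration ::
  "(nat \<Rightarrow> 'x set) \<Rightarrow> (nat \<Rightarrow> 'x \<Rightarrow> 'g) \<Rightarrow> (nat \<Rightarrow> 'x \<Rightarrow> 'x) \<Rightarrow> bool" where
  "enumeration E p q \<longleftrightarrow>
     (\<forall>n. E n \<in> sets (completion \<mu>)) \<and> (\<forall>n. p n \<in> measurable (completion \<mu>) R\<^sub>H) \<and>
     (\<forall>n. q n \<in> measurable (completion \<mu>) R\<^sub>T) \<and>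
     (\<forall>s\<in>S. \<forall>F :: 'g \<Rightarrow> 'x \<Rightarrow> ennreal. (\<integral>\<^sup>+h. F h (act h s) \<partial>count_space (hitting_set H act T s)) =
        (\<Sum>n. indicator (E n) s * F (p n s) (q n s))) \<and>
     (\<forall>K. compact K \<longrightarrow> (\<exists>N. \<forall>n\<ge>N. \<forall>s\<in>E n. p n s \<notin> K))"

lemma ex_enumeration: "\<exists>E p q. enumeration E p q"
proof -
  obtain U where U: "open U" "0 \<in> U" "{h \<in> H. act h ` T \<inter> T \<noteq> {}} \<inter> (H \<inter> U) = {0}"
    using sep unfolding separated_def openin_open by auto
  obtain D :: "nat \<Rightarrow> 'g set" where D: "\<And>n. D n \<in> sets borel" "disjoint_family D" "(\<Union>n. D n) = UNIV"
    and D_diff: "\<And>n h h'. h \<in> D n \<Longrightarrow> h' \<in> D n \<Longrightarrow> h - h' \<in> U"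
    and D_compact: "\<And>K. compact K \<Longrightarrow> \<exists>n. \<forall>i\<ge>n. D i \<inter> K = {}"
    using small_disjoint_cover[OF U(1,2)] by metis
  interpret countable_sections \<mu> B D 0
  proof (rule countable_sections.intro)
    fix n h h' s assume h: "h \<in> D n" "h' \<in> D n" "(h, s) \<in> B" "(h', s) \<in> B"
    then have *: "h \<in> H" "h' \<in> H" "s \<in> S" "act h s \<in> T" "act h' s \<in> T" by (auto simp: B_iff)
    then have "act (h - h') (act h' s) = act h s"
      using act_add[of "h - h'" h' s] closed_subgroupD(6)[OF H] by simp
    then have "act (h - h') ` T \<inter> T \<noteq> {}" using * by force
    then have "h - h' \<in> {h \<in> H. act h ` T \<inter> T \<noteq> {}} \<inter> (H \<inter> U)"
      using D_diff[OF h(1,2)] closed_subgroupD(6)[OF H] * by blast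
    then show "h = h'" using U(3) by simp
  qed (rule lc fin B_sets D)+
  obtain t0 where t0: "t0 \<in> T" using T_nonempty by blast
  have sel_H: "sel n s \<in> H" for n s
    using sel_mem[of s n] closed_subgroupD(2)[OF H] by (cases "s \<in> sdom n") (auto simp: B_iff sel_def)
  have sel_R: "sel n \<in> measurable (completion \<mu>) R\<^sub>H" for n
    using sel_measurable[of n] sel_H by (auto simp: measurable_restrict_space2_iff)
  define q where "q n s = (if s \<in> sdom n then act (sel n s) s else t0)" for n s
  have q_sel: "q n s = act (sel n s) s" if "s \<in> sdom n" for n s using that by (simp add: q_def)
  have "q n \<in> measurable (completion \<mu>) R\<^sub>T" for n
  proof (rule measurable_R\<^sub>T)
    have [measurable]: "(\<lambda>s. s) \<in> measurable (completion \<mu>) \<mu>" by (rule measurable_completion) simp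
    have t0': "t0 \<in> space \<mu>" using t0 T_subset space_mu by auto
    have "(\<lambda>s. act (sel n s) s) \<in> measurable (completion \<mu>) \<mu>"
      by (rule act_measurable[OF sel_R]) measurable
    then show "q n \<in> measurable (completion \<mu>) \<mu>"
      unfolding q_def using t0' sdom_sets[of n] sets.sets_into_space[OF sdom_sets, of n]
      by (intro measurable_If_set) (auto simp: Int_absorb2)
    show "q n s \<in> T" for s
      using sel_mem[of s n] t0 by (auto simp: q_def B_iff)
  qed
  moreover have "(\<integral>\<^sup>+h. F h (act h s) \<partial>count_space (hitting_set H act T s)) =
        (\<Sum>n. indicator (sdom n) s * F (sel n s) (q n s))" if "s \<in> S" for s and F :: "'g \<Rightarrow> 'x \<Rightarrow> ennreal"
    unfolding hitting_set_eq[OF that] sum_sections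
    by (intro suminf_cong) (simp add: q_sel indicator_def)
  moreover have "\<exists>N. \<forall>n\<ge>N. \<forall>s\<in>sdom n. sel n s \<notin> K" if "compact K" for K
    using D_compact[OF that] sel_mem by blast
  ultimately have "enumeration sdom sel q"
    unfolding enumeration_def using sdom_sets sel_R by blast
  then show ?thesis by blast
qed

lemma enumerationD:
  assumes "enumeration E p q"
  shows "E n \<in> sets (completion \<mu>)" "p n \<in> measurable (completion \<mu>) R\<^sub>H"
    "q n \<in> measurable (completion \<mu>) R\<^sub>T"
    "s \<in> S \<Longrightarrow> (\<integral>\<^sup>+h. F h (act h s) \<partial>count_space (hitting_set H act T s)) =
      (\<Sum>n. indicator (E n) s * F (p n s) (q n s))"
    "compact K \<Longrightarrow> \<exists>N. \<forall>n\<ge>N. \<forall>s\<in>E n. p n s \<notin> K"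
proof -
  note * = assms[unfolded enumeration_def]
  show "E n \<in> sets (completion \<mu>)" by (rule *[THEN conjunct1, rule_format])
  show "p n \<in> measurable (completion \<mu>) R\<^sub>H" by (rule *[THEN conjunct2, THEN conjunct1, rule_format])
  show "q n \<in> measurable (completion \<mu>) R\<^sub>T"
    by (rule *[THEN conjunct2, THEN conjunct2, THEN conjunct1, rule_format])
  show "(\<integral>\<^sup>+h. F h (act h s) \<partial>count_space (hitting_set H act T s)) =
      (\<Sum>n. indicator (E n) s * F (p n s) (q n s))" if "s \<in> S"
    by (rule *[THEN conjunct2, THEN conjunct2, THEN conjunct2, THEN conjunct1, rule_format, OF that])
  show "\<exists>N. \<forall>n\<ge>N. \<forall>s\<in>E n. p n s \<notin> K" if "compact K"
    by (rule *[THEN conjunct2, THEN conjunct2, THEN conjunct2, THEN conjunct2, rule_format, OF that])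
qed

lemma hitting_sum_measurable:
  fixes f :: "'g \<times> 'x \<Rightarrow> ennreal"
  assumes [measurable]: "f \<in> borel_measurable (R\<^sub>H \<Otimes>\<^sub>M R\<^sub>T)"
  shows "(\<lambda>s. \<integral>\<^sup>+h. f (- h, act h s) \<partial>count_space (hitting_set H act T s)) \<in> borel_measurable (completion \<mu>)"
proof -
  obtain E p q where enum: "enumeration E p q" using ex_enumeration by blast
  note [measurable] = enumerationD(1-3)[OF enum]
  have "(\<lambda>s. \<Sum>n. indicator (E n) s * f (- p n s, q n s)) \<in> borel_measurable (completion \<mu>)"
    by measurable
  then show ?thesis
    by (rule measurable_cong[THEN iffD1, rotated])
      (simp add: space_mu enumerationD(4)[OF enum, of _ "\<lambda>h t. f (- h, t)"])
qed

end

locale invariant_separated_action = separated_action H act S T \<mu> + haar_subgroup H m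
  for H :: "'g::{topological_group_add, t2_space, second_countable_topology} set"
    and act :: "'g \<Rightarrow> 'x::polish_space \<Rightarrow> 'x" and S T :: "'x set" and \<mu> :: "'x measure"
    and m :: "'g measure" +
  assumes unimod: "unimodular H" and inv: "\<And>h. h \<in> H \<Longrightarrow> distr \<mu> \<mu> (act h) = \<mu>"
begin

definition hitting_integral :: "('g \<times> 'x \<Rightarrow> ennreal) \<Rightarrow> ennreal" where
  "hitting_integral f = (\<integral>\<^sup>+s. (\<integral>\<^sup>+h. f (- h, act h s) \<partial>count_space (hitting_set H act T s)) \<partial>\<mu>)"

lemma hitting_integral_translate:
  assumes [measurable]: "f \<in> borel_measurable (R\<^sub>H \<Otimes>\<^sub>M R\<^sub>T)" and u: "u \<in> H"
  shows "hitting_integral (\<lambda>p. f (u + fst p, snd p)) = hitting_integral f"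
proof -
  have "(\<integral>\<^sup>+h. f (- h, act h (act u s)) \<partial>count_space (hitting_set H act T (act u s))) =
      (\<integral>\<^sup>+h. f (u + - h, act h s) \<partial>count_space (hitting_set H act T s))" if s: "s \<in> S" for s
  proof -
    have "bij_betw (\<lambda>h. h - u) (hitting_set H act T s) (hitting_set H act T (act u s))"
    proof (rule bij_betw_byWitness[where f' = "\<lambda>h. h + u"])
      show "(\<lambda>h. h - u) ` hitting_set H act T s \<subseteq> hitting_set H act T (act u s)"
        using u s act_add[of _ u s, symmetric] closed_subgroupD[OF H] by (auto simp: hitting_set_def)
      show "(\<lambda>h. h + u) ` hitting_set H act T (act u s) \<subseteq> hitting_set H act T s"
        using u s act_add[of _ u s] closed_subgroupD[OF H] by (auto simp: hitting_set_def)
    qed auto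
    then have "(\<integral>\<^sup>+h. f (- h, act h (act u s)) \<partial>count_space (hitting_set H act T (act u s))) =
      (\<integral>\<^sup>+h. f (- (h - u), act (h - u) (act u s)) \<partial>count_space (hitting_set H act T s))"
      by (rule nn_integral_bij_count_space[symmetric])
    also have "\<dots> = (\<integral>\<^sup>+h. f (u + - h, act h s) \<partial>count_space (hitting_set H act T s))"
      using u s closed_subgroupD[OF H]
      by (intro nn_integral_cong) (simp add: hitting_set_def act_add[symmetric])
    finally show ?thesis .
  qed
  then have "hitting_integral (\<lambda>p. f (u + fst p, snd p)) =
     (\<integral>\<^sup>+s. (\<integral>\<^sup>+h. f (- h, act h (act u s)) \<partial>count_space (hitting_set H act T (act u s))) \<partial>\<mu>)"
    unfolding hitting_integral_def by (intro nn_integral_cong) (simp add: space_mu)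
  also have "\<dots> = hitting_integral f"
    unfolding hitting_integral_def
    by (rule nn_integral_completion_distr[OF act_fixed_measurable[OF u] inv[OF u] hitting_sum_measurable]) measurable
  finally show ?thesis .
qed

lemma hitting_integral_enumeration:
  assumes enum: "enumeration E p q" and [measurable]: "f \<in> borel_measurable (R\<^sub>H \<Otimes>\<^sub>M R\<^sub>T)"
  shows "hitting_integral f = (\<Sum>n. \<integral>\<^sup>+s. indicator (E n) s * f (- p n s, q n s) \<partial>completion \<mu>)"
proof -
  note [measurable] = enumerationD(1-3)[OF enum]
  have "hitting_integral f = (\<integral>\<^sup>+s. (\<Sum>n. indicator (E n) s * f (- p n s, q n s)) \<partial>\<mu>)"
    unfolding hitting_integral_def
    by (intro nn_integral_cong) (simp add: space_mu enumerationD(4)[OF enum, of _ "\<lambda>h t. f (- h, t)"])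
  also have "\<dots> = (\<integral>\<^sup>+s. (\<Sum>n. indicator (E n) s * f (- p n s, q n s)) \<partial>completion \<mu>)"
    by (rule nn_integral_completion[symmetric])
  also have "\<dots> = (\<Sum>n. \<integral>\<^sup>+s. indicator (E n) s * f (- p n s, q n s) \<partial>completion \<mu>)"
    by (rule nn_integral_suminf) measurable
  finally show ?thesis .
qed

lemma hitting_integral_average:
  assumes C: "compact C" "C \<subseteq> H" "\<And>g. - g \<in> C \<longleftrightarrow> g \<in> C"
    and [measurable]: "f \<in> borel_measurable (R\<^sub>H \<Otimes>\<^sub>M R\<^sub>T)"
  shows "(\<integral>\<^sup>+h. hitting_integral (\<lambda>p. indicator C (fst p) * f (h, snd p)) \<partial>m) = emeasure m C * hitting_integral f"
proof -
  obtain E p q where enum: "enumeration E p q" using ex_enumeration by blast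
  note [measurable] = enumerationD(1-3)[OF enum]
  interpret m: sigma_finite_measure m by (rule sigma_finite_m)
  interpret c: finite_measure "completion \<mu>" by (rule finite_measure_completion[OF fin])
  interpret pair_sigma_finite m "completion \<mu>" ..
  have C_meas[measurable]: "C \<in> sets R\<^sub>H"
    using compact_sets_m[OF C(1,2)] sets_m by simp
  have swap: "(\<integral>\<^sup>+h. (\<Sum>n. \<integral>\<^sup>+s. G n h s \<partial>completion \<mu>) \<partial>m) = (\<Sum>n. \<integral>\<^sup>+s. \<integral>\<^sup>+h. G n h s \<partial>m \<partial>completion \<mu>)"
    if [measurable]: "\<And>n. (\<lambda>(h, s). G n h s) \<in> borel_measurable (R\<^sub>H \<Otimes>\<^sub>M completion \<mu>)" for G :: "nat \<Rightarrow> 'g \<Rightarrow> 'x \<Rightarrow> ennreal"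
  proof -
    have G: "case_prod (G n) \<in> borel_measurable (m \<Otimes>\<^sub>M completion \<mu>)" for n
      by measurable
    then have "(\<integral>\<^sup>+h. (\<Sum>n. \<integral>\<^sup>+s. G n h s \<partial>completion \<mu>) \<partial>m) =
        (\<Sum>n. \<integral>\<^sup>+h. \<integral>\<^sup>+s. G n h s \<partial>completion \<mu> \<partial>m)"
      by (intro nn_integral_suminf c.borel_measurable_nn_integral)
    also have "\<dots> = (\<Sum>n. \<integral>\<^sup>+s. \<integral>\<^sup>+h. G n h s \<partial>m \<partial>completion \<mu>)"
      using Fubini'[OF G] by simp
    finally show ?thesis .
  qed
  have "(\<integral>\<^sup>+h. hitting_integral (\<lambda>p. indicator C (fst p) * f (h, snd p)) \<partial>m) =
     (\<integral>\<^sup>+h. (\<Sum>n. \<integral>\<^sup>+s. indicator (E n) s * (indicator C (- p n s) * f (h, q n s)) \<partial>completion \<mu>) \<partial>m)"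
    by (intro nn_integral_cong) (subst hitting_integral_enumeration[OF enum], auto simp: space_m space_restrict_space)
  also have "\<dots> = (\<Sum>n. \<integral>\<^sup>+s. \<integral>\<^sup>+h. indicator (E n) s * (indicator C (- p n s) * f (h, q n s)) \<partial>m \<partial>completion \<mu>)"
    by (rule swap) measurable
  also have "\<dots> = (\<Sum>n. \<integral>\<^sup>+s. \<integral>\<^sup>+h. indicator (E n) s * (indicator C (- p n s) * f (h + - p n s, q n s)) \<partial>m \<partial>completion \<mu>)"
  proof (rule suminf_cong, rule nn_integral_cong)
    fix n s assume "s \<in> space (completion \<mu>)"
    then have ps: "- p n s \<in> H" and qs: "q n s \<in> T"
      using measurable_space[OF enumerationD(2)[OF enum], of s n] measurable_space[OF enumerationD(3)[OF enum], of s n]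
      by (auto simp: space_restrict_space closed_subgroupD[OF H])
    have "(\<lambda>h. indicator (E n) s * (indicator C (- p n s) * f (h, q n s))) \<in> borel_measurable m"
      using qs by (intro borel_measurable_times_ennreal) (auto simp: space_restrict_space)
    then show "(\<integral>\<^sup>+h. indicator (E n) s * (indicator C (- p n s) * f (h, q n s)) \<partial>m) =
      (\<integral>\<^sup>+h. indicator (E n) s * (indicator C (- p n s) * f (h + - p n s, q n s)) \<partial>m)"
      by (rule nn_integral_right[OF unimod ps, symmetric])
  qed
  also have "\<dots> = (\<integral>\<^sup>+h. (\<Sum>n. \<integral>\<^sup>+s. indicator (E n) s * (indicator C (- p n s) * f (h + - p n s, q n s)) \<partial>completion \<mu>) \<partial>m)"
    by (rule swap[symmetric]) measurable
  also have "\<dots> = (\<integral>\<^sup>+h. hitting_integral (\<lambda>p. indicator C (fst p) * f (h + fst p, snd p)) \<partial>m)"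
    by (intro nn_integral_cong) (subst hitting_integral_enumeration[OF enum], auto simp: space_m space_restrict_space)
  also have "\<dots> = (\<integral>\<^sup>+h. hitting_integral (\<lambda>p. indicator C (- h + fst p) * f (fst p, snd p)) \<partial>m)"
  proof (intro nn_integral_cong)
    fix h assume "h \<in> space m"
    then have h: "h \<in> H" "- h \<in> H" using closed_subgroupD[OF H] by (auto simp: space_m)
    have "(\<lambda>p. indicator C (fst p) * f (h + fst p, snd p)) \<in> borel_measurable (R\<^sub>H \<Otimes>\<^sub>M R\<^sub>T)"
      using h by (measurable, auto simp: space_restrict_space)
    from hitting_integral_translate[OF this h(2)]
    show "hitting_integral (\<lambda>p. indicator C (fst p) * f (h + fst p, snd p)) =
      hitting_integral (\<lambda>p. indicator C (- h + fst p) * f (fst p, snd p))"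
      by (simp add: add.assoc[symmetric])
  qed
  also have "\<dots> = (\<integral>\<^sup>+h. (\<Sum>n. \<integral>\<^sup>+s. indicator (E n) s * (indicator C (- h + - p n s) * f (- p n s, q n s)) \<partial>completion \<mu>) \<partial>m)"
    by (intro nn_integral_cong) (subst hitting_integral_enumeration[OF enum], auto simp: space_m space_restrict_space closed_subgroupD[OF H])
  also have "\<dots> = (\<Sum>n. \<integral>\<^sup>+s. \<integral>\<^sup>+h. indicator (E n) s * (indicator C (- h + - p n s) * f (- p n s, q n s)) \<partial>m \<partial>completion \<mu>)"
    by (rule swap) measurable
  also have "\<dots> = (\<Sum>n. \<integral>\<^sup>+s. emeasure m C * (indicator (E n) s * f (- p n s, q n s)) \<partial>completion \<mu>)"
  proof (rule suminf_cong, rule nn_integral_cong)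
    fix n s assume "s \<in> space (completion \<mu>)"
    then have ps: "p n s \<in> H"
      using measurable_space[OF enumerationD(2)[OF enum], of s n] by (auto simp: space_restrict_space)
    have C_m: "C \<in> sets m" using C_meas sets_m by simp
    have "(\<integral>\<^sup>+h. indicator (E n) s * (indicator C (- h + - p n s) * f (- p n s, q n s)) \<partial>m) =
      (\<integral>\<^sup>+h. indicator C (p n s + h) * (indicator (E n) s * f (- p n s, q n s)) \<partial>m)"
      using C(3)[of "p n s + _"]
      by (intro nn_integral_cong) (simp add: indicator_def minus_add)
    also have "\<dots> = (\<integral>\<^sup>+h. indicator C h * (indicator (E n) s * f (- p n s, q n s)) \<partial>m)"
      using C_m by (intro nn_integral_left[OF ps]) auto
    also have "\<dots> = emeasure m C * (indicator (E n) s * f (- p n s, q n s))"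
      using C_m by (simp add: nn_integral_multc)
    finally show "(\<integral>\<^sup>+h. indicator (E n) s * (indicator C (- h + - p n s) * f (- p n s, q n s)) \<partial>m) =
      emeasure m C * (indicator (E n) s * f (- p n s, q n s))" .
  qed
  also have "\<dots> = emeasure m C * hitting_integral f"
    by (simp add: hitting_integral_enumeration[OF enum] nn_integral_cmult)
  finally show ?thesis .
qed

theorem ex_transverse_measure:
  "\<exists>\<nu>. sets \<nu> = sets R\<^sub>T \<and> finite_measure \<nu> \<and>
    (\<forall>f\<in>borel_measurable (R\<^sub>H \<Otimes>\<^sub>M R\<^sub>T). hitting_integral f = (\<integral>\<^sup>+h. \<integral>\<^sup>+t. f (h, t) \<partial>\<nu> \<partial>m))"
proof -
  obtain C where C: "compact C" "C \<subseteq> H" "\<And>g. - g \<in> C \<longleftrightarrow> g \<in> C"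
    and C0: "emeasure m C \<noteq> 0" "emeasure m C \<noteq> \<infinity>"
    using ex_symmetric_compact by blast
  have C_meas[measurable]: "C \<in> sets R\<^sub>H"
    using compact_sets_m[OF C(1,2)] sets_m by simp
  obtain E p q where enum: "enumeration E p q" using ex_enumeration by blast
  note [measurable] = enumerationD(1-3)[OF enum]
  interpret c: finite_measure "completion \<mu>" by (rule finite_measure_completion[OF fin])
  define Q where "Q = count_space (UNIV :: nat set) \<Otimes>\<^sub>M completion \<mu>"
  define w where "w = (\<lambda>(n, s). inverse (emeasure m C) * (indicator (E n) s * indicator C (- p n s)))"
  have w[measurable]: "w \<in> borel_measurable Q"
    unfolding Q_def w_def by (intro measurable_pair_measure_countable1) (auto intro!: borel_measurable_times_ennreal)
  have q'[measurable]: "(\<lambda>(n, s). q n s) \<in> measurable Q R\<^sub>T"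
    unfolding Q_def by (intro measurable_pair_measure_countable1) auto
  define \<nu> where "\<nu> = distr (density Q w) R\<^sub>T (\<lambda>(n, s). q n s)"
  have \<nu>: "(\<integral>\<^sup>+t. g t \<partial>\<nu>) = inverse (emeasure m C) * hitting_integral (\<lambda>p. indicator C (fst p) * g (snd p))"
    if [measurable]: "g \<in> borel_measurable R\<^sub>T" for g
  proof -
    have "(\<integral>\<^sup>+t. g t \<partial>\<nu>) = (\<integral>\<^sup>+x. g (case x of (n, s) \<Rightarrow> q n s) \<partial>density Q w)"
      unfolding \<nu>_def by (intro nn_integral_distr) auto
    also have "\<dots> = (\<integral>\<^sup>+x. w x * g (case x of (n, s) \<Rightarrow> q n s) \<partial>Q)"
      by (intro nn_integral_density) auto
    also have "\<dots> = (\<integral>\<^sup>+n. \<integral>\<^sup>+s. w (n, s) * g (q n s) \<partial>completion \<mu> \<partial>count_space UNIV)"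
      unfolding Q_def using w q'
      by (subst c.nn_integral_fst[symmetric]) (auto simp: Q_def)
    also have "\<dots> = (\<Sum>n. \<integral>\<^sup>+s. w (n, s) * g (q n s) \<partial>completion \<mu>)"
      by (rule nn_integral_count_space_nat)
    also have "\<dots> = (\<Sum>n. inverse (emeasure m C) * (\<integral>\<^sup>+s. indicator (E n) s * (indicator C (- p n s) * g (q n s)) \<partial>completion \<mu>))"
      by (subst nn_integral_cmult[symmetric]) (auto simp: w_def mult.assoc)
    also have "\<dots> = inverse (emeasure m C) * hitting_integral (\<lambda>p. indicator C (fst p) * g (snd p))"
      by (simp add: hitting_integral_enumeration[OF enum])
    finally show ?thesis .
  qed
  have "hitting_integral f = (\<integral>\<^sup>+h. \<integral>\<^sup>+t. f (h, t) \<partial>\<nu> \<partial>m)"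
    if f[measurable]: "f \<in> borel_measurable (R\<^sub>H \<Otimes>\<^sub>M R\<^sub>T)" for f
  proof -
    have "(\<integral>\<^sup>+h. \<integral>\<^sup>+t. f (h, t) \<partial>\<nu> \<partial>m) =
      (\<integral>\<^sup>+h. inverse (emeasure m C) * hitting_integral (\<lambda>p. indicator C (fst p) * f (h, snd p)) \<partial>m)"
      by (intro nn_integral_cong \<nu>) (auto simp: space_m space_restrict_space)
    also have "\<dots> = inverse (emeasure m C) * (\<integral>\<^sup>+h. hitting_integral (\<lambda>p. indicator C (fst p) * f (h, snd p)) \<partial>m)"
    proof (rule nn_integral_cmult)
      have "(\<lambda>h. \<Sum>n. \<integral>\<^sup>+s. indicator (E n) s * (indicator C (- p n s) * f (h, q n s)) \<partial>completion \<mu>) \<in> borel_measurable m"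
        by measurable
      then show "(\<lambda>h. hitting_integral (\<lambda>p. indicator C (fst p) * f (h, snd p))) \<in> borel_measurable m"
        by (rule measurable_cong[THEN iffD1, rotated])
          (subst hitting_integral_enumeration[OF enum], auto simp: space_m space_restrict_space)
    qed
    also have "\<dots> = inverse (emeasure m C) * (emeasure m C * hitting_integral f)"
      by (simp only: hitting_integral_average[OF C f])
    also have "\<dots> = hitting_integral f"
      using C0 ennreal_divide_self[of "emeasure m C"]
      by (simp add: mult.assoc[symmetric] divide_ennreal_def mult.commute[of "inverse _"] less_top[symmetric])
    finally show ?thesis by simp
  qed
  moreover have "sets \<nu> = sets R\<^sub>T" by (simp add: \<nu>_def)
  moreover have "finite_measure \<nu>"
  proof (rule finite_measureI)
    obtain N where N: "\<And>n s. n \<ge> N \<Longrightarrow> s \<in> E n \<Longrightarrow> p n s \<notin> C" using enumerationD(5)[OF enum C(1)] by blast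
    have "hitting_integral (\<lambda>p. indicator C (fst p) * 1) =
      (\<Sum>n. \<integral>\<^sup>+s. indicator (E n) s * (indicator C (- p n s) * 1) \<partial>completion \<mu>)"
      by (subst hitting_integral_enumeration[OF enum]) auto
    also have "\<dots> = (\<Sum>n<N. \<integral>\<^sup>+s. indicator (E n) s * (indicator C (- p n s) * 1) \<partial>completion \<mu>)"
    proof (rule suminf_finite)
      fix n assume "n \<notin> {..<N}"
      then have "indicator (E n) s * (indicator C (- p n s) * 1) = (0::ennreal)" for s
        using N[of n s] C(3)[of "p n s"] by (simp add: indicator_def)
      then show "(\<integral>\<^sup>+s. indicator (E n) s * (indicator C (- p n s) * 1) \<partial>completion \<mu>) = 0"
        by (simp only: nn_integral_const mult_zero_left)
    qed simp
    also have "\<dots> \<le> (\<Sum>n<N. \<integral>\<^sup>+s. 1 \<partial>completion \<mu>)"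
      by (intro sum_mono nn_integral_mono) (simp add: indicator_def)
    also have "\<dots> < \<infinity>"
      using c.emeasure_finite[of "space \<mu>"] by (simp add: ennreal_mult_less_top less_top of_nat_less_top)
    finally have "(\<integral>\<^sup>+t. 1 \<partial>\<nu>) < \<infinity>"
      using C0 by (subst \<nu>) (auto simp: less_top[symmetric] ennreal_mult_eq_top_iff)
    then show "emeasure \<nu> (space \<nu>) \<noteq> \<infinity>" by simp
  qed
  ultimately show ?thesis by blast
qed

end

section \<open>Haar measure of a semidirect product\<close>

lemma measurable_completion_snd:
  assumes "sigma_finite_measure N"
  shows "snd \<in> measurable (completion (M \<Otimes>\<^sub>M N)) (completion N)"
proof (rule measurableI)
  interpret sigma_finite_measure N by fact
  fix A assume "A \<in> sets (completion N)"
  then obtain S X X' where A: "A = S \<union> X" "X \<subseteq> X'" "X' \<in> null_sets N" "S \<in> sets N"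
    by (rule sets_completionE)
  have "snd -` A \<inter> space (completion (M \<Otimes>\<^sub>M N)) = space M \<times> S \<union> space M \<times> (X \<inter> space N)"
    using sets.sets_into_space[OF A(4)] by (auto simp: A(1) space_pair_measure)
  moreover have "space M \<times> (X \<inter> space N) \<subseteq> space M \<times> X'" using A(2) by auto
  moreover have "space M \<times> X' \<in> null_sets (M \<Otimes>\<^sub>M N)"
  proof (rule null_setsI)
    have "emeasure (M \<Otimes>\<^sub>M N) (space M \<times> X') = emeasure M (space M) * emeasure N X'"
      using A(3) by (intro emeasure_pair_measure_Times) auto
    then show "emeasure (M \<Otimes>\<^sub>M N) (space M \<times> X') = 0"
      using null_setsD1[OF A(3)] by simp
  qed (use A(3) in auto)
  moreover have "space M \<times> S \<in> sets (M \<Otimes>\<^sub>M N)" using A(4) by simp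
  ultimately show "snd -` A \<inter> space (completion (M \<Otimes>\<^sub>M N)) \<in> sets (completion (M \<Otimes>\<^sub>M N))"
    by (intro sets_completionI) 
qed (auto simp: space_pair_measure)

lemma measurable_completion_pair:
  assumes f: "f \<in> measurable (M \<Otimes>\<^sub>M completion N) K" and N: "sigma_finite_measure N"
  shows "f \<in> measurable (completion (M \<Otimes>\<^sub>M N)) K"
proof -
  have "(\<lambda>p. (fst p, snd p)) \<in> measurable (completion (M \<Otimes>\<^sub>M N)) (M \<Otimes>\<^sub>M completion N)"
    by (intro measurable_Pair measurable_completion_snd[OF N]) (rule measurable_completion, rule measurable_fst)
  from measurable_compose[OF this f] show ?thesis by simp
qed

lemma nn_integral_count_space_Sigma:
  fixes f :: "'c \<times> 'd \<Rightarrow> ennreal"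
  shows "(\<integral>\<^sup>+a. (\<integral>\<^sup>+b. f (a, b) \<partial>count_space (B a)) \<partial>count_space A) = (\<integral>\<^sup>+p. f p \<partial>count_space (Sigma A B))"
proof -
  have ind: "(\<integral>\<^sup>+x. g x \<partial>count_space X) = (\<integral>\<^sup>+x. g x * indicator X x \<partial>count_space UNIV)"
    for g :: "'c \<Rightarrow> ennreal" and X
    by (rule nn_integral_count_space_indicator) (simp add: NO_MATCH_def)
  have ind': "(\<integral>\<^sup>+x. g x \<partial>count_space X) = (\<integral>\<^sup>+x. g x * indicator X x \<partial>count_space UNIV)"
    for g :: "'d \<Rightarrow> ennreal" and X
    by (rule nn_integral_count_space_indicator) (simp add: NO_MATCH_def)
  have "(\<integral>\<^sup>+a. (\<integral>\<^sup>+b. f (a, b) \<partial>count_space (B a)) \<partial>count_space A) =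
    (\<integral>\<^sup>+a. (\<integral>\<^sup>+b. f (a, b) * indicator (Sigma A B) (a, b) \<partial>count_space UNIV) \<partial>count_space UNIV)"
    unfolding ind[where X = A] ind'[where X = "B _"] by (intro nn_integral_cong) (simp add: indicator_def)
  also have "\<dots> = (\<integral>\<^sup>+p. f p * indicator (Sigma A B) p \<partial>count_space UNIV)"
    by (rule nn_integral_fst_count_space)
  also have "\<dots> = (\<integral>\<^sup>+p. f p \<partial>count_space (Sigma A B))"
    by (rule nn_integral_count_space_indicator[symmetric]) simp
  finally show ?thesis .
qed

lemma sets_restrict_space_UNIV: "sets (restrict_space M UNIV) = sets M"
  by (simp add: sets_restrict_space image_def)

lemma borel_action_restrict:
  fixes act :: "'g::topological_group_add \<Rightarrow> 'x::polish_space \<Rightarrow> 'x"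
  assumes act: "borel_action UNIV UNIV act" and S: "S \<in> sets borel"
    and closed: "\<And>h s. h \<in> H \<Longrightarrow> s \<in> S \<Longrightarrow> act h s \<in> S"
  shows "borel_action H S act"
proof -
  have "(\<lambda>(h, s). act h s) \<in> measurable (restrict_space borel UNIV \<Otimes>\<^sub>M restrict_space borel UNIV) (restrict_space borel UNIV)"
    using act by (simp add: borel_action_def)
  then have meas: "(\<lambda>(h, s). act h s) \<in> measurable (borel \<Otimes>\<^sub>M borel) borel"
    by (subst (asm) measurable_cong_sets[OF sets_pair_measure_cong[OF sets_restrict_space_UNIV sets_restrict_space_UNIV]
          sets_restrict_space_UNIV])
  have "(\<lambda>p. (fst p, snd p)) \<in> measurable (restrict_space borel H \<Otimes>\<^sub>M restrict_space borel S) (borel \<Otimes>\<^sub>M borel)"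
    by (intro measurable_Pair measurable_compose[OF measurable_fst measurable_restrict_space1]
        measurable_compose[OF measurable_snd measurable_restrict_space1]) auto
  from measurable_compose[OF this meas]
  have "(\<lambda>(h, s). act h s) \<in> measurable (restrict_space borel H \<Otimes>\<^sub>M restrict_space borel S) (restrict_space borel S)"
    using closed by (auto simp: measurable_restrict_space2_iff space_pair_measure space_restrict_space)
  then show ?thesis using act S by (simp add: borel_action_def)
qed

context invariant_separated_action
begin

lemma is_transverse_measureI:
  assumes "sets \<nu> = sets R\<^sub>T"
    and "\<And>f. f \<in> borel_measurable (R\<^sub>H \<Otimes>\<^sub>M R\<^sub>T) \<Longrightarrow> hitting_integral f = (\<integral>\<^sup>+h. \<integral>\<^sup>+t. f (h, t) \<partial>\<nu> \<partial>m)"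
  shows "is_transverse_measure H m act T \<mu> \<nu>"
  unfolding is_transverse_measure_def
proof (intro conjI allI impI)
  fix f :: "'g \<times> 'x \<Rightarrow> real"
  assume "f \<in> borel_measurable (R\<^sub>H \<Otimes>\<^sub>M R\<^sub>T) \<and> (\<forall>p\<in>H \<times> T. 0 \<le> f p) \<and> bounded (f ` (H \<times> T))"
  then have "(\<lambda>p. ennreal (f p)) \<in> borel_measurable (R\<^sub>H \<Otimes>\<^sub>M R\<^sub>T)"
    by (intro measurable_compose[OF _ measurable_ennreal]) (rule conjunct1)
  from assms(2)[OF this]
  show "(\<integral>\<^sup>+ s. (\<integral>\<^sup>+ h. ennreal (f (- h, act h s)) \<partial>count_space (hitting_set H act T s)) \<partial>\<mu>)
        = (\<integral>\<^sup>+ h. (\<integral>\<^sup>+ t. ennreal (f (h, t)) \<partial>\<nu>) \<partial>m)"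
    by (simp add: hitting_integral_def)
qed (fact assms(1))

end

locale semidirect_haar =
  fixes N L :: "'g::{topological_group_add, t2_space, second_countable_topology} set"
    and m\<^sub>G m\<^sub>N m\<^sub>L :: "'g measure"
  assumes lc: "locally compact (UNIV :: 'g set)"
    and N: "closed_subgroup N" and L: "closed_subgroup L"
    and NL: "set_product N L = UNIV" "N \<inter> L = {0}"
    and haar: "haar_measure UNIV m\<^sub>G" "haar_measure N m\<^sub>N" "haar_measure L m\<^sub>L"
    and m\<^sub>G: "\<And>W\<^sub>N W\<^sub>L. W\<^sub>N \<in> sets (restrict_space borel N) \<Longrightarrow> W\<^sub>L \<in> sets (restrict_space borel L) \<Longrightarrow>
           emeasure m\<^sub>G (set_product W\<^sub>N W\<^sub>L) = emeasure m\<^sub>N W\<^sub>N * emeasure m\<^sub>L W\<^sub>L"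
begin

sublocale N: haar_subgroup N m\<^sub>N
  by (rule haar_subgroup.intro[OF lc N haar(2)])

sublocale L: haar_subgroup L m\<^sub>L
  by (rule haar_subgroup.intro[OF lc L haar(3)])

lemma sum_eq_iff:
  assumes "n \<in> N" "n' \<in> N" "l \<in> L" "l' \<in> L"
  shows "n + l = n' + l' \<longleftrightarrow> n = n' \<and> l = l'"
proof
  assume eq: "n + l = n' + l'"
  have "- n' + n = l' - l"
  proof -
    have "- n' + (n + l) - l = - n' + (n' + l') - l" unfolding eq ..
    then show ?thesis by (simp add: add.assoc[symmetric] del: add_uminus_conv_diff)
  qed
  note d = this
  have "- n' + n \<in> N" using assms closed_subgroupD(3,4)[OF N] by blast
  moreover have "- n' + n \<in> L" unfolding d using assms closed_subgroupD(6)[OF L] by blast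
  ultimately have "- n' + n = 0" using NL(2) by blast
  moreover from this d have "l' - l = 0" by (simp only:)
  ultimately show "n = n' \<and> l = l'"
    using add.inverse_unique[of "- n'" n] by simp
qed simp

definition "proj\<^sub>N g = (THE n. n \<in> N \<and> - n + g \<in> L)"
definition "proj\<^sub>L g = - proj\<^sub>N g + g"

lemma proj_sum: "n \<in> N \<Longrightarrow> l \<in> L \<Longrightarrow> proj\<^sub>N (n + l) = n \<and> proj\<^sub>L (n + l) = l"
proof -
  assume *: "n \<in> N" "l \<in> L"
  have "proj\<^sub>N (n + l) = n"
    unfolding proj\<^sub>N_def
  proof (rule the_equality)
    show "n \<in> N \<and> - n + (n + l) \<in> L" using * by (simp add: add.assoc[symmetric])
    fix n' assume n': "n' \<in> N \<and> - n' + (n + l) \<in> L"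
    have "n + l = n' + (- n' + (n + l))" by (simp add: add.assoc[symmetric])
    then show "n' = n" using sum_eq_iff[of n n' l "- n' + (n + l)"] * n' by blast
  qed
  then show ?thesis by (simp add: proj\<^sub>L_def add.assoc[symmetric])
qed

lemma ex_sum: "\<exists>n\<in>N. \<exists>l\<in>L. g = n + l"
  using NL(1) unfolding set_product_def by blast

lemma proj_mem: "proj\<^sub>N g \<in> N" "proj\<^sub>L g \<in> L" "proj\<^sub>N g + proj\<^sub>L g = g"
proof -
  obtain n l where "n \<in> N" "l \<in> L" "g = n + l" using ex_sum by blast
  then show "proj\<^sub>N g \<in> N" "proj\<^sub>L g \<in> L" "proj\<^sub>N g + proj\<^sub>L g = g" using proj_sum by auto
qed

text \<open>Borel measurability of the projections is where \<open>\<sigma>\<close>-compactness replaces the open mapping theorem.\<close>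

lemma proj\<^sub>N_borel: "proj\<^sub>N \<in> borel_measurable borel"
proof (rule borel_measurableI)
  fix S :: "'g set" assume S: "open S"
  obtain C :: "nat \<Rightarrow> 'g set" where C: "\<And>i. compact (C i)" "S = (\<Union>i. C i)"
    using open_eq_UN_compact[OF lc S] by blast
  obtain K :: "nat \<Rightarrow> 'g set" where K: "\<And>i. compact (K i)" "UNIV = (\<Union>i. K i)"
    using open_eq_UN_compact[OF lc open_UNIV] by blast
  let ?P = "\<lambda>i j. (\<lambda>p. fst p + snd p) ` ((C i \<inter> N) \<times> (K j \<inter> L))"
  have "proj\<^sub>N -` S = (\<Union>i. \<Union>j. ?P i j)"
  proof (intro subset_antisym subsetI)
    fix g assume "g \<in> proj\<^sub>N -` S"
    then obtain i j where "proj\<^sub>N g \<in> C i" "proj\<^sub>L g \<in> K j" using C(2) K(2) by blast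
    then show "g \<in> (\<Union>i. \<Union>j. ?P i j)"
      using proj_mem[of g] by (intro UN_I[of i] UN_I[of j] image_eqI[of _ _ "(proj\<^sub>N g, proj\<^sub>L g)"]) auto
  next
    fix g assume "g \<in> (\<Union>i. \<Union>j. ?P i j)"
    then obtain i n l where "n \<in> C i" "n \<in> N" "l \<in> L" "g = n + l" by auto
    then show "g \<in> proj\<^sub>N -` S" using proj_sum C(2) by auto
  qed
  moreover have "closed (?P i j)" for i j
    using compact_Int_closed[OF C(1) closed_subgroupD(1)[OF N]] compact_Int_closed[OF K(1) closed_subgroupD(1)[OF L]]
    by (intro compact_imp_closed compact_continuous_image compact_Times continuous_intros)
  ultimately show "proj\<^sub>N -` S \<inter> space borel \<in> sets borel" by (auto intro!: sets.countable_UN)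
qed

lemma proj_measurable:
  "proj\<^sub>N \<in> measurable borel (restrict_space borel N)" "proj\<^sub>L \<in> measurable borel (restrict_space borel L)"
proof -
  have "(uminus :: 'g \<Rightarrow> 'g) \<in> borel_measurable borel"
    by (intro borel_measurable_continuous_onI continuous_intros)
  from measurable_compose[OF proj\<^sub>N_borel this] have "proj\<^sub>L \<in> borel_measurable borel"
    unfolding proj\<^sub>L_def by (intro borel_measurable_add) auto
  then show "proj\<^sub>N \<in> measurable borel (restrict_space borel N)" "proj\<^sub>L \<in> measurable borel (restrict_space borel L)"
    using proj\<^sub>N_borel proj_mem by (auto simp: measurable_restrict_space2_iff)
qed

lemma sets_m\<^sub>G[measurable_cong]: "sets m\<^sub>G = sets borel"
  using haar(1) by (simp add: haar_measure_def sets_restrict_space_UNIV)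

lemma nn_integral_m\<^sub>G:
  assumes [measurable]: "f \<in> borel_measurable borel"
  shows "(\<integral>\<^sup>+g. f g \<partial>m\<^sub>G) = (\<integral>\<^sup>+n. \<integral>\<^sup>+l. f (n + l) \<partial>m\<^sub>L \<partial>m\<^sub>N)"
proof -
  interpret L': sigma_finite_measure m\<^sub>L by (rule L.sigma_finite_m)
  let ?R = "restrict_space borel N \<Otimes>\<^sub>M restrict_space borel L"
  have sets_R: "sets (m\<^sub>N \<Otimes>\<^sub>M m\<^sub>L) = sets ?R" by (rule sets_pair_measure_cong[OF N.sets_m L.sets_m])
  have dec: "(\<lambda>g. (proj\<^sub>N g, proj\<^sub>L g)) \<in> measurable m\<^sub>G ?R"
    using proj_measurable by (subst measurable_cong_sets[OF sets_m\<^sub>G refl]) (intro measurable_Pair)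
  have "m\<^sub>N \<Otimes>\<^sub>M m\<^sub>L = distr m\<^sub>G ?R (\<lambda>g. (proj\<^sub>N g, proj\<^sub>L g))"
  proof (rule pair_measure_eqI[OF N.sigma_finite_m L.sigma_finite_m])
    fix A B assume "A \<in> sets m\<^sub>N" "B \<in> sets m\<^sub>L"
    then have AB: "A \<in> sets (restrict_space borel N)" "B \<in> sets (restrict_space borel L)"
      by (simp_all add: N.sets_m L.sets_m)
    then have sub: "A \<subseteq> N" "B \<subseteq> L"
      using sets.sets_into_space by (fastforce simp: space_restrict_space)+
    have "emeasure (distr m\<^sub>G ?R (\<lambda>g. (proj\<^sub>N g, proj\<^sub>L g))) (A \<times> B) =
        emeasure m\<^sub>G ((\<lambda>g. (proj\<^sub>N g, proj\<^sub>L g)) -` (A \<times> B) \<inter> space m\<^sub>G)"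
      using AB by (intro emeasure_distr[OF dec]) auto
    also have "(\<lambda>g. (proj\<^sub>N g, proj\<^sub>L g)) -` (A \<times> B) \<inter> space m\<^sub>G = set_product A B"
    proof (intro subset_antisym subsetI)
      fix g assume "g \<in> (\<lambda>g. (proj\<^sub>N g, proj\<^sub>L g)) -` (A \<times> B) \<inter> space m\<^sub>G"
      then show "g \<in> set_product A B" unfolding set_product_def using proj_mem(3)[of g, symmetric] by auto
    next
      fix g assume "g \<in> set_product A B"
      then obtain a b where "a \<in> A" "b \<in> B" "g = a + b" unfolding set_product_def by blast
      then show "g \<in> (\<lambda>g. (proj\<^sub>N g, proj\<^sub>L g)) -` (A \<times> B) \<inter> space m\<^sub>G"
        using proj_sum[OF subsetD[OF sub(1)] subsetD[OF sub(2)], of a b] sets_eq_imp_space_eq[OF sets_m\<^sub>G]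
        by simp
    qed
    finally show "emeasure m\<^sub>N A * emeasure m\<^sub>L B = emeasure (distr m\<^sub>G ?R (\<lambda>g. (proj\<^sub>N g, proj\<^sub>L g))) (A \<times> B)"
      using m\<^sub>G[OF AB] by simp
  qed (simp add: sets_R)
  note eq = this
  have add: "(\<lambda>p. f (fst p + snd p)) \<in> borel_measurable ?R"
    by (intro measurable_compose[OF _ assms] borel_measurable_add
        measurable_compose[OF measurable_fst measurable_restrict_space1]
        measurable_compose[OF measurable_snd measurable_restrict_space1]) auto
  then have add': "(\<lambda>p. f (fst p + snd p)) \<in> borel_measurable (m\<^sub>N \<Otimes>\<^sub>M m\<^sub>L)"
    by (simp add: measurable_cong_sets[OF sets_R refl])
  have "(\<integral>\<^sup>+g. f g \<partial>m\<^sub>G) = (\<integral>\<^sup>+g. f (proj\<^sub>N g + proj\<^sub>L g) \<partial>m\<^sub>G)"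
    by (simp add: proj_mem(3))
  also have "\<dots> = (\<integral>\<^sup>+p. f (fst p + snd p) \<partial>(m\<^sub>N \<Otimes>\<^sub>M m\<^sub>L))"
    unfolding eq using add by (subst nn_integral_distr[OF dec]) simp_all
  also have "\<dots> = (\<integral>\<^sup>+n. \<integral>\<^sup>+l. f (n + l) \<partial>m\<^sub>L \<partial>m\<^sub>N)"
    by (subst L'.nn_integral_fst[OF add', symmetric]) simp
  finally show ?thesis .
qed

end

section \<open>Transverse measures in stages\<close>

locale semidirect_transverse = semidirect_haar N L m\<^sub>G m\<^sub>N m\<^sub>L
  for N L :: "'g::{topological_group_add, t2_space, second_countable_topology} set"
    and m\<^sub>G m\<^sub>N m\<^sub>L :: "'g measure" +
  fixes act :: "'g \<Rightarrow> 'x::polish_space \<Rightarrow> 'x" and Y Z :: "'x set" and \<mu> :: "'x measure"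
  assumes normal: "normal_subgroup N"
    and unimod: "unimodular N" "unimodular L"
    and conj_inv: "\<And>l. l \<in> L \<Longrightarrow> distr m\<^sub>N m\<^sub>N (\<lambda>n. l + n - l) = m\<^sub>N"
    and action: "borel_action UNIV UNIV act"
    and Z_sets: "Z \<in> sets borel" and Z_sep: "separated UNIV act Z"
    and Y_def: "Y = translates act L Z"
    and Y_sets: "Y \<in> sets borel" and Y_sep: "separated N act Y"
    and sets_mu[measurable_cong]: "sets \<mu> = sets borel" and fin: "finite_measure \<mu>"
    and inv: "\<And>g. distr \<mu> \<mu> (act g) = \<mu>"
begin

abbreviation "R\<^sub>N \<equiv> restrict_space borel N"
abbreviation "R\<^sub>L \<equiv> restrict_space borel L"
abbreviation "R\<^sub>Y \<equiv> restrict_space borel Y"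
abbreviation "R\<^sub>Z \<equiv> restrict_space borel Z"

lemma act_zero: "act 0 x = x" and act_add: "act (g + h) x = act g (act h x)"
  using action by (simp_all add: borel_action_def)

lemma act_Y: "l \<in> L \<Longrightarrow> act l y \<in> Y \<longleftrightarrow> y \<in> Y"
proof -
  have *: "act l y \<in> Y" if "l \<in> L" "y \<in> Y" for l y
    using that closed_subgroupD(3)[OF L] unfolding Y_def translates_def
    by (force simp: act_add[symmetric])
  assume l: "l \<in> L"
  moreover have "act (- l) (act l y) = y" by (simp add: act_add[symmetric] act_zero)
  ultimately show ?thesis using *[of l y] *[of "- l" "act l y"] closed_subgroupD(4)[OF L] by auto
qed

lemma Z_subset_Y: "Z \<subseteq> Y"
  using closed_subgroupD(2)[OF L] unfolding Y_def translates_def by (force simp: act_zero)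

lemma act_borel: "act g \<in> measurable \<mu> \<mu>"
proof -
  have "(\<lambda>(h, s). act h s) \<in> measurable (restrict_space borel UNIV \<Otimes>\<^sub>M restrict_space borel UNIV) (restrict_space borel UNIV)"
    using action by (simp add: borel_action_def)
  from measurable_compose[OF measurable_Pair1' this, of g] show ?thesis
    by (simp add: space_restrict_space measurable_cong_sets[OF sets_restrict_space_UNIV sets_restrict_space_UNIV]
        measurable_cong_sets[OF sets_mu sets_mu])
qed

sublocale N: invariant_separated_action N act UNIV Y \<mu> m\<^sub>N
proof (intro invariant_separated_action.intro invariant_separated_action_axioms.intro separated_action.intro)
  show "borel_action N UNIV act" by (rule borel_action_restrict[OF action]) auto
qed (use lc N Y_sep Y_sets sets_mu fin N.haar_subgroup_axioms unimod inv in \<open>auto simp: sets_restrict_space_UNIV\<close>)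

lemma L_action: "borel_action L Y act"
  by (rule borel_action_restrict[OF action Y_sets]) (simp add: act_Y)

lemma nn_integral_conj:
  assumes l: "l \<in> L" and [measurable]: "f \<in> borel_measurable R\<^sub>N"
  shows "(\<integral>\<^sup>+n. f (l + n - l) \<partial>m\<^sub>N) = (\<integral>\<^sup>+n. f n \<partial>m\<^sub>N)"
proof -
  have conj_N: "l + n - l \<in> N" if "n \<in> N" for n using normal that by (simp add: normal_subgroup_def)
  have "continuous_on UNIV (\<lambda>n. l + n - l)" by (intro continuous_intros)
  then have "(\<lambda>n. l + n - l) \<in> borel_measurable borel" by (rule borel_measurable_continuous_onI)
  then have "(\<lambda>n. l + n - l) \<in> measurable R\<^sub>N R\<^sub>N"
    using conj_N by (auto simp: measurable_restrict_space2_iff space_restrict_space intro: measurable_restrict_space1)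
  then have "(\<lambda>n. l + n - l) \<in> measurable m\<^sub>N m\<^sub>N"
    by (simp add: measurable_cong_sets[OF N.sets_m N.sets_m])
  then have "(\<integral>\<^sup>+n. f (l + n - l) \<partial>m\<^sub>N) = (\<integral>\<^sup>+n. f n \<partial>distr m\<^sub>N m\<^sub>N (\<lambda>n. l + n - l))"
    by (simp add: nn_integral_distr)
  then show ?thesis by (simp add: conj_inv[OF l])
qed

lemma hitting_integral_conj:
  assumes l: "l \<in> L" and f[measurable]: "f \<in> borel_measurable (R\<^sub>N \<Otimes>\<^sub>M R\<^sub>Y)"
  shows "N.hitting_integral (\<lambda>p. f (- l + fst p + l, snd p)) = N.hitting_integral (\<lambda>p. f (fst p, act l (snd p)))"
proof -
  have conj_N: "l + n - l \<in> N" "- l + n + l \<in> N" if "n \<in> N" for n l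
    using normal that unfolding normal_subgroup_def by (metis, metis diff_minus_eq_add)
  have "continuous_on UNIV (\<lambda>n. - l + n + l)" by (intro continuous_intros)
  then have "(\<lambda>n. - l + n + l) \<in> borel_measurable borel" by (rule borel_measurable_continuous_onI)
  then have conj_meas: "(\<lambda>n. - l + n + l) \<in> measurable R\<^sub>N R\<^sub>N"
    using conj_N by (auto simp: measurable_restrict_space2_iff space_restrict_space intro: measurable_restrict_space1)
  have "(\<lambda>p. (- l + fst p + l, snd p)) \<in> measurable (R\<^sub>N \<Otimes>\<^sub>M R\<^sub>Y) (R\<^sub>N \<Otimes>\<^sub>M R\<^sub>Y)"
    by (intro measurable_Pair measurable_compose[OF measurable_fst conj_meas] measurable_snd)
  from measurable_compose[OF this f]
  have meas: "(\<lambda>p. f (- l + fst p + l, snd p)) \<in> borel_measurable (R\<^sub>N \<Otimes>\<^sub>M R\<^sub>Y)" .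
  have canc: "- l + (l + n - l) + l = n" "l + (- l + n + l) - l = n" for n
    by (simp_all add: diff_conv_add_uminus add.assoc del: add_uminus_conv_diff)
  let ?g = "\<lambda>x. \<integral>\<^sup>+k. f (- l + - k + l, act k x) \<partial>count_space (hitting_set N act Y x)"
  have "?g (act l x) = (\<integral>\<^sup>+n. f (- n, act l (act n x)) \<partial>count_space (hitting_set N act Y x))" for x
  proof -
    have eq: "act (l + n - l) (act l x) = act l (act n x)" for n
    proof -
      have "l + n - l + l = l + n" by simp
      then show ?thesis by (simp only: act_add[symmetric])
    qed
    have "bij_betw (\<lambda>n. l + n - l) (hitting_set N act Y x) (hitting_set N act Y (act l x))"
    proof (rule bij_betw_byWitness[where f' = "\<lambda>n. - l + n + l"])
      show "(\<lambda>n. l + n - l) ` hitting_set N act Y x \<subseteq> hitting_set N act Y (act l x)"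
        using conj_N(1)[of _ l] l by (auto simp: hitting_set_def eq act_Y)
      show "(\<lambda>n. - l + n + l) ` hitting_set N act Y (act l x) \<subseteq> hitting_set N act Y x"
      proof (intro image_subsetI)
        fix n assume n: "n \<in> hitting_set N act Y (act l x)"
        have "act l (act (- l + n + l) x) = act n (act l x)"
          using eq[of "- l + n + l"] by (simp add: add.assoc[symmetric])
        then have "act (- l + n + l) x \<in> Y" using n act_Y[OF l, of "act (- l + n + l) x"] by (simp add: hitting_set_def)
        then show "- l + n + l \<in> hitting_set N act Y x" using n conj_N(2)[of n l] by (simp add: hitting_set_def)
      qed
    qed (simp_all add: canc)
    then have "?g (act l x) = (\<integral>\<^sup>+n. f (- l + - (l + n - l) + l, act (l + n - l) (act l x)) \<partial>count_space (hitting_set N act Y x))"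
      by (rule nn_integral_bij_count_space[symmetric])
    also have "\<dots> = (\<integral>\<^sup>+n. f (- n, act l (act n x)) \<partial>count_space (hitting_set N act Y x))"
    proof (rule nn_integral_cong)
      fix n
      have "- (l + n - l) = l + - n - l"
        by (rule minus_unique) (simp add: diff_conv_add_uminus add.assoc del: add_uminus_conv_diff)
      then have "- l + - (l + n - l) + l = - n" by (simp only: canc)
      then show "f (- l + - (l + n - l) + l, act (l + n - l) (act l x)) = f (- n, act l (act n x))"
        by (simp only: eq)
    qed
    finally show ?thesis .
  qed
  then have "N.hitting_integral (\<lambda>p. f (fst p, act l (snd p))) = (\<integral>\<^sup>+x. ?g (act l x) \<partial>\<mu>)"
    unfolding N.hitting_integral_def by simp
  also have "\<dots> = (\<integral>\<^sup>+x. ?g x \<partial>\<mu>)"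
    using N.hitting_sum_measurable[OF meas] by (intro nn_integral_completion_distr[OF act_borel inv]) simp
  also have "\<dots> = N.hitting_integral (\<lambda>p. f (- l + fst p + l, snd p))"
    unfolding N.hitting_integral_def by simp
  finally show ?thesis by simp
qed

end

locale semidirect_transverse_nu = semidirect_transverse N L m\<^sub>G m\<^sub>N m\<^sub>L act Y Z \<mu>
  for N L :: "'g::{topological_group_add, t2_space, second_countable_topology} set"
    and m\<^sub>G m\<^sub>N m\<^sub>L :: "'g measure"
    and act :: "'g \<Rightarrow> 'x::polish_space \<Rightarrow> 'x" and Y Z :: "'x set" and \<mu> :: "'x measure" +
  fixes \<nu> :: "'x measure"
  assumes sets_nu[measurable_cong]: "sets \<nu> = sets R\<^sub>Y" and fin_nu: "finite_measure \<nu>"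
    and nu: "\<And>f. f \<in> borel_measurable (R\<^sub>N \<Otimes>\<^sub>M R\<^sub>Y) \<Longrightarrow> N.hitting_integral f = (\<integral>\<^sup>+n. \<integral>\<^sup>+y. f (n, y) \<partial>\<nu> \<partial>m\<^sub>N)"
begin

sublocale L': separated_action L act Y Z \<nu>
proof (rule separated_action.intro)
  show "Z \<in> sets (restrict_space borel Y)"
    using Z_sets Z_subset_Y Y_sets by (auto simp: sets_restrict_space_iff)
  obtain U where U: "open U" "0 \<in> U" "{h. act h ` Z \<inter> Z \<noteq> {}} \<inter> U = {0}"
    using Z_sep unfolding separated_def by auto
  then show "separated L act Z"
    unfolding separated_def using closed_subgroupD(2)[OF L]
    by (intro exI[of _ "L \<inter> U"]) (auto simp: openin_open)
qed (rule lc L L_action sets_nu fin_nu)+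

lemma nu_invariant:
  assumes l: "l \<in> L"
  shows "distr \<nu> \<nu> (act l) = \<nu>"
proof -
  have act_l[measurable]: "act l \<in> measurable R\<^sub>Y R\<^sub>Y"
    using L'.act_fixed_measurable[OF l] by (simp add: measurable_cong_sets[OF sets_nu sets_nu])
  have "is_transverse_measure N m\<^sub>N act Y \<mu> (distr \<nu> \<nu> (act l))"
  proof (rule N.is_transverse_measureI)
    fix f :: "'g \<times> 'x \<Rightarrow> ennreal" assume f[measurable]: "f \<in> borel_measurable (R\<^sub>N \<Otimes>\<^sub>M R\<^sub>Y)"
    have "continuous_on UNIV (\<lambda>n. - l + n + l)" by (intro continuous_intros)
    then have "(\<lambda>n. - l + n + l) \<in> borel_measurable borel" by (rule borel_measurable_continuous_onI)
    moreover have "- l + n + l \<in> N" if "n \<in> N" for n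
      using normal that unfolding normal_subgroup_def by (metis diff_minus_eq_add)
    ultimately have [measurable]: "(\<lambda>n. - l + n + l) \<in> measurable R\<^sub>N R\<^sub>N"
      by (auto simp: measurable_restrict_space2_iff space_restrict_space intro: measurable_restrict_space1)
    interpret finite_measure \<nu> by (rule fin_nu)
    have "N.hitting_integral f = (\<integral>\<^sup>+n. \<integral>\<^sup>+y. f (n, y) \<partial>\<nu> \<partial>m\<^sub>N)" by (rule nu[OF f])
    also have "\<dots> = (\<integral>\<^sup>+n. \<integral>\<^sup>+y. f (- l + n - - l, y) \<partial>\<nu> \<partial>m\<^sub>N)"
      by (rule nn_integral_conj[symmetric]) (use l closed_subgroupD(4)[OF L] in measurable)
    also have "\<dots> = N.hitting_integral (\<lambda>p. f (- l + fst p + l, snd p))"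
      by (subst nu) simp_all
    also have "\<dots> = N.hitting_integral (\<lambda>p. f (fst p, act l (snd p)))"
      by (rule hitting_integral_conj[OF l f])
    also have "\<dots> = (\<integral>\<^sup>+n. \<integral>\<^sup>+y. f (n, act l y) \<partial>\<nu> \<partial>m\<^sub>N)"
      by (subst nu) simp_all
    also have "\<dots> = (\<integral>\<^sup>+n. \<integral>\<^sup>+y. f (n, y) \<partial>distr \<nu> \<nu> (act l) \<partial>m\<^sub>N)"
      by (intro nn_integral_cong) (subst nn_integral_distr, auto simp: N.space_m space_restrict_space L'.act_fixed_measurable[OF l])
    finally show "N.hitting_integral f = (\<integral>\<^sup>+n. \<integral>\<^sup>+y. f (n, y) \<partial>distr \<nu> \<nu> (act l) \<partial>m\<^sub>N)" .
  qed (simp add: sets_nu)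
  then show ?thesis
    using N.transverse_measure_unique N.is_transverse_measureI[OF sets_nu nu] by blast
qed

sublocale L': invariant_separated_action L act Y Z \<nu> m\<^sub>L
  by (intro invariant_separated_action.intro invariant_separated_action_axioms.intro
      L'.separated_action_axioms L.haar_subgroup_axioms unimod nu_invariant)

lemma hitting_sum_iterated:
  fixes F :: "'g \<times> 'x \<Rightarrow> ennreal"
  shows "(\<integral>\<^sup>+g. F (- g, act g x) \<partial>count_space (hitting_set UNIV act Z x)) =
    (\<integral>\<^sup>+n. (\<integral>\<^sup>+l. F (- n + - l, act l (act n x)) \<partial>count_space (hitting_set L act Z (act n x)))
      \<partial>count_space (hitting_set N act Y x))"
proof -
  let ?S = "Sigma (hitting_set N act Y x) (\<lambda>n. hitting_set L act Z (act n x))"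
  have "bij_betw (\<lambda>p. snd p + fst p) ?S (hitting_set UNIV act Z x)"
  proof (rule bij_betwI')
    fix p q assume "p \<in> ?S" "q \<in> ?S"
    then have mem: "fst p \<in> N" "fst q \<in> N" "snd p \<in> L" "snd q \<in> L" by (auto simp: hitting_set_def)
    have "snd p + fst p = snd q + fst q \<longleftrightarrow> - fst p + - snd p = - fst q + - snd q"
      by (metis add.inverse_inverse minus_add)
    also have "\<dots> \<longleftrightarrow> - fst p = - fst q \<and> - snd p = - snd q"
      using mem closed_subgroupD(4)[OF N] closed_subgroupD(4)[OF L] by (intro sum_eq_iff) auto
    also have "\<dots> \<longleftrightarrow> p = q" by (auto simp: prod_eq_iff)
    finally show "(snd p + fst p = snd q + fst q) = (p = q)" .
  next
    fix p assume "p \<in> ?S"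
    then show "snd p + fst p \<in> hitting_set UNIV act Z x" by (auto simp: hitting_set_def act_add)
  next
    fix g assume g: "g \<in> hitting_set UNIV act Z x"
    obtain n l where nl: "n \<in> N" "l \<in> L" "- g = n + l" using ex_sum by blast
    then have g_eq: "g = - l + - n" by (metis add.inverse_inverse minus_add)
    have mem: "- n \<in> N" "- l \<in> L" using nl closed_subgroupD(4)[OF N] closed_subgroupD(4)[OF L] by auto
    have "act (- l) (act (- n) x) \<in> Z" using g unfolding g_eq hitting_set_def act_add[symmetric] by simp
    moreover from this have "act (- n) x \<in> Y" using act_Y[OF mem(2)] Z_subset_Y by blast
    ultimately have "(- n, - l) \<in> ?S" using mem by (auto simp: hitting_set_def)
    then show "\<exists>p\<in>?S. g = snd p + fst p" using g_eq by force
  qed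
  then have "(\<integral>\<^sup>+g. F (- g, act g x) \<partial>count_space (hitting_set UNIV act Z x)) =
      (\<integral>\<^sup>+p. F (- (snd p + fst p), act (snd p + fst p) x) \<partial>count_space ?S)"
    by (rule nn_integral_bij_count_space[symmetric])
  also have "\<dots> = (\<integral>\<^sup>+p. F (- fst p + - snd p, act (snd p) (act (fst p) x)) \<partial>count_space ?S)"
    by (simp only: minus_add act_add)
  also have "\<dots> = (\<integral>\<^sup>+n. (\<integral>\<^sup>+l. F (- n + - l, act l (act n x)) \<partial>count_space (hitting_set L act Z (act n x)))
      \<partial>count_space (hitting_set N act Y x))"
    by (subst nn_integral_count_space_Sigma[symmetric]) simp
  finally show ?thesis .
qed

text \<open>The inner sum over the \<open>L\<close>-hitting set is measurable only with respect to the completion, so it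
  is replaced by a Borel version; the exceptional null set is invisible to the \<open>N\<close>-hitting sum.\<close>

lemma hitting_integral_completion:
  assumes \<Phi>: "\<Phi> \<in> borel_measurable (R\<^sub>N \<Otimes>\<^sub>M completion \<nu>)"
  shows "N.hitting_integral \<Phi> = (\<integral>\<^sup>+n. \<integral>\<^sup>+y. \<Phi> (n, y) \<partial>\<nu> \<partial>m\<^sub>N)"
proof -
  interpret \<nu>: finite_measure \<nu> by (rule fin_nu)
  interpret m: sigma_finite_measure m\<^sub>N by (rule N.sigma_finite_m)
  interpret pair_sigma_finite m\<^sub>N \<nu> ..
  have sets_prod: "sets (m\<^sub>N \<Otimes>\<^sub>M \<nu>) = sets (R\<^sub>N \<Otimes>\<^sub>M R\<^sub>Y)"
    by (rule sets_pair_measure_cong[OF N.sets_m sets_nu])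
  have "\<Phi> \<in> borel_measurable (m\<^sub>N \<Otimes>\<^sub>M completion \<nu>)"
    using \<Phi> by (simp add: measurable_cong_sets[OF sets_pair_measure_cong[OF N.sets_m refl] refl])
  then have "\<Phi> \<in> borel_measurable (completion (m\<^sub>N \<Otimes>\<^sub>M \<nu>))"
    by (rule measurable_completion_pair) unfold_locales
  then obtain \<Phi>' where \<Phi>': "\<Phi>' \<in> borel_measurable (m\<^sub>N \<Otimes>\<^sub>M \<nu>)" "AE p in m\<^sub>N \<Otimes>\<^sub>M \<nu>. \<Phi> p = \<Phi>' p"
    using completion_ex_borel_measurable by blast
  obtain E where E: "{p \<in> space (m\<^sub>N \<Otimes>\<^sub>M \<nu>). \<Phi> p \<noteq> \<Phi>' p} \<subseteq> E" "emeasure (m\<^sub>N \<Otimes>\<^sub>M \<nu>) E = 0" "E \<in> sets (m\<^sub>N \<Otimes>\<^sub>M \<nu>)"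
    using \<Phi>'(2) by (rule AE_E)
  have ind: "indicator E \<in> borel_measurable (R\<^sub>N \<Otimes>\<^sub>M R\<^sub>Y)"
    using E(3) sets_prod by (intro borel_measurable_indicator) simp
  have "N.hitting_integral (indicator E) = (\<integral>\<^sup>+n. \<integral>\<^sup>+y. indicator E (n, y) \<partial>\<nu> \<partial>m\<^sub>N)"
    by (rule nu[OF ind])
  also have "\<dots> = 0"
    using E(2) by (simp add: \<nu>.emeasure_pair_measure[OF E(3)])
  finally have "(\<integral>\<^sup>+x. (\<integral>\<^sup>+n. indicator E (- n, act n x) \<partial>count_space (hitting_set N act Y x)) \<partial>completion \<mu>) = 0"
    by (simp add: N.hitting_integral_def nn_integral_completion)
  then have "AE x in completion \<mu>. (\<integral>\<^sup>+n. indicator E (- n, act n x) \<partial>count_space (hitting_set N act Y x)) = 0"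
    by (subst (asm) nn_integral_0_iff_AE[OF N.hitting_sum_measurable[OF ind]])
  then have AE_E: "AE x in \<mu>. \<forall>n\<in>hitting_set N act Y x. (- n, act n x) \<notin> E"
    unfolding AE_completion_iff
    by eventually_elim (auto simp: nn_integral_0_iff_AE AE_count_space indicator_def)
  have "N.hitting_integral \<Phi> = N.hitting_integral \<Phi>'"
    unfolding N.hitting_integral_def
  proof (rule nn_integral_cong_AE)
    from AE_E show "AE x in \<mu>. (\<integral>\<^sup>+n. \<Phi> (- n, act n x) \<partial>count_space (hitting_set N act Y x)) =
        (\<integral>\<^sup>+n. \<Phi>' (- n, act n x) \<partial>count_space (hitting_set N act Y x))"
    proof eventually_elim
      case (elim x)
      have "\<Phi> (- n, act n x) = \<Phi>' (- n, act n x)" if n: "n \<in> hitting_set N act Y x" for n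
      proof -
        have "(- n, act n x) \<in> space (m\<^sub>N \<Otimes>\<^sub>M \<nu>)"
          using n closed_subgroupD(4)[OF N] by (simp add: space_pair_measure N.space_m L'.space_mu hitting_set_def)
        then show ?thesis using elim n E(1) by blast
      qed
      then show ?case by (intro nn_integral_cong) simp
    qed
  qed
  also have "\<dots> = (\<integral>\<^sup>+n. \<integral>\<^sup>+y. \<Phi>' (n, y) \<partial>\<nu> \<partial>m\<^sub>N)"
    using \<Phi>'(1) by (intro nu) (simp add: measurable_cong_sets[OF sets_prod refl])
  also have "\<dots> = (\<integral>\<^sup>+n. \<integral>\<^sup>+y. \<Phi> (n, y) \<partial>\<nu> \<partial>m\<^sub>N)"
  proof (rule nn_integral_cong_AE)
    have "AE n in m\<^sub>N. AE y in \<nu>. \<Phi> (n, y) = \<Phi>' (n, y)" using AE_pair[OF \<Phi>'(2)] .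
    then show "AE n in m\<^sub>N. (\<integral>\<^sup>+y. \<Phi>' (n, y) \<partial>\<nu>) = (\<integral>\<^sup>+y. \<Phi> (n, y) \<partial>\<nu>)"
      by eventually_elim (auto intro!: nn_integral_cong_AE elim: eventually_mono)
  qed
  finally show ?thesis .
qed

lemma transverse_measure_composition:
  assumes sets_rho[measurable_cong]: "sets \<rho> = sets R\<^sub>Z" and fin_rho: "finite_measure \<rho>"
    and rho: "\<And>f. f \<in> borel_measurable (R\<^sub>L \<Otimes>\<^sub>M R\<^sub>Z) \<Longrightarrow> L'.hitting_integral f = (\<integral>\<^sup>+l. \<integral>\<^sup>+z. f (l, z) \<partial>\<rho> \<partial>m\<^sub>L)"
    and F[measurable]: "F \<in> borel_measurable (borel \<Otimes>\<^sub>M R\<^sub>Z)"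
  shows "(\<integral>\<^sup>+x. (\<integral>\<^sup>+g. F (- g, act g x) \<partial>count_space (hitting_set UNIV act Z x)) \<partial>\<mu>) =
    (\<integral>\<^sup>+g. \<integral>\<^sup>+z. F (g, z) \<partial>\<rho> \<partial>m\<^sub>G)"
proof -
  interpret \<rho>: finite_measure \<rho> by (rule fin_rho)
  define \<Phi> where "\<Phi> p = (\<integral>\<^sup>+l. F (fst p + - l, act l (snd p)) \<partial>count_space (hitting_set L act Z (snd p)))" for p
  obtain E p q where enum: "L'.enumeration E p q" using L'.ex_enumeration by blast
  note [measurable] = L'.enumerationD(1-3)[OF enum]
  have p_borel[measurable]: "p j \<in> borel_measurable (completion \<nu>)" for j
    using L'.enumerationD(2)[OF enum, of j] by (simp add: measurable_restrict_space2_iff)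
  have um[measurable]: "(uminus :: 'g \<Rightarrow> 'g) \<in> borel_measurable borel"
    by (intro borel_measurable_continuous_onI continuous_intros)
  have idN[measurable]: "(\<lambda>n. n) \<in> borel_measurable R\<^sub>N"
    by (intro measurable_restrict_space1) simp
  have "(\<lambda>r. \<Sum>j. indicator (E j) (snd r) * F (fst r + - p j (snd r), q j (snd r))) \<in> borel_measurable (R\<^sub>N \<Otimes>\<^sub>M completion \<nu>)"
    by measurable
  then have "\<Phi> \<in> borel_measurable (R\<^sub>N \<Otimes>\<^sub>M completion \<nu>)"
    by (rule measurable_cong[THEN iffD1, rotated])
      (auto simp: \<Phi>_def space_pair_measure L'.space_mu
        L'.enumerationD(4)[OF enum, of _ "\<lambda>l z. F (n - l, z)" for n])
  then have "N.hitting_integral \<Phi> = (\<integral>\<^sup>+n. \<integral>\<^sup>+y. \<Phi> (n, y) \<partial>\<nu> \<partial>m\<^sub>N)"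
    by (rule hitting_integral_completion)
  moreover have "(\<integral>\<^sup>+x. (\<integral>\<^sup>+g. F (- g, act g x) \<partial>count_space (hitting_set UNIV act Z x)) \<partial>\<mu>) = N.hitting_integral \<Phi>"
    unfolding N.hitting_integral_def \<Phi>_def by (simp add: hitting_sum_iterated)
  moreover have "(\<integral>\<^sup>+y. \<Phi> (n, y) \<partial>\<nu>) = (\<integral>\<^sup>+l. \<integral>\<^sup>+z. F (n + l, z) \<partial>\<rho> \<partial>m\<^sub>L)" for n
  proof -
    have [measurable]: "(\<lambda>l. l) \<in> borel_measurable R\<^sub>L" by (intro measurable_restrict_space1) simp
    have "(\<lambda>r. F (n + fst r, snd r)) \<in> borel_measurable (R\<^sub>L \<Otimes>\<^sub>M R\<^sub>Z)" by measurable
    from rho[OF this] show ?thesis by (simp add: L'.hitting_integral_def \<Phi>_def)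
  qed
  moreover have "(\<integral>\<^sup>+g. \<integral>\<^sup>+z. F (g, z) \<partial>\<rho> \<partial>m\<^sub>G) = (\<integral>\<^sup>+n. \<integral>\<^sup>+l. \<integral>\<^sup>+z. F (n + l, z) \<partial>\<rho> \<partial>m\<^sub>L \<partial>m\<^sub>N)"
    by (rule nn_integral_m\<^sub>G) measurable
  ultimately show ?thesis by simp
qed

end

theorem theorem1p7:
  fixes N L :: "'g::{topological_group_add, t2_space, second_countable_topology} set"
    and m\<^sub>G m\<^sub>N m\<^sub>L :: "'g measure"
    and act :: "'g \<Rightarrow> 'x::polish_space \<Rightarrow> 'x"
    and Y Z :: "'x set"
    and \<mu> :: "'x measure"
  assumes "locally compact (UNIV :: 'g set)"
    and "closed_subgroup N" and "normal_subgroup N" and "closed_subgroup L"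
    and "set_product N L = UNIV" and "N \<inter> L = {0}"
    and "haar_measure UNIV m\<^sub>G" and "haar_measure N m\<^sub>N" and "haar_measure L m\<^sub>L"
    and "\<And>W\<^sub>N W\<^sub>L. W\<^sub>N \<in> sets (restrict_space borel N) \<Longrightarrow> W\<^sub>L \<in> sets (restrict_space borel L) \<Longrightarrow>
           emeasure m\<^sub>G (set_product W\<^sub>N W\<^sub>L) = emeasure m\<^sub>N W\<^sub>N * emeasure m\<^sub>L W\<^sub>L"
    and "unimodular N" and "unimodular L"
    and "\<And>l. l \<in> L \<Longrightarrow> distr m\<^sub>N m\<^sub>N (\<lambda>n. l + n - l) = m\<^sub>N"
    and "borel_action UNIV UNIV act"
    and "cross_section UNIV act UNIV Z" and "separated UNIV act Z"
    and "Y = translates act L Z"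
    and "cross_section N act UNIV Y" and "separated N act Y"
    and "finite_invariant_borel_measure UNIV act UNIV \<mu>"
  shows "finite_invariant_borel_measure L act Y (transverse_measure N m\<^sub>N act Y \<mu>) \<and>
         transverse_measure UNIV m\<^sub>G act Z \<mu> =
           transverse_measure L m\<^sub>L act Z (transverse_measure N m\<^sub>N act Y \<mu>)"
proof -
  interpret semidirect_transverse N L m\<^sub>G m\<^sub>N m\<^sub>L act Y Z \<mu>
  proof (intro semidirect_transverse.intro semidirect_haar.intro semidirect_transverse_axioms.intro)
    show "Z \<in> sets borel" "Y \<in> sets borel"
      using assms(15,18) by (simp_all add: cross_section_def sets_restrict_space_UNIV)
    show "sets \<mu> = sets borel" "finite_measure \<mu>" "\<And>g. distr \<mu> \<mu> (act g) = \<mu>"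
      using assms(20) by (simp_all add: finite_invariant_borel_measure_def sets_restrict_space_UNIV)
  qed (fact assms)+
  obtain \<nu> where \<nu>: "sets \<nu> = sets R\<^sub>Y" "finite_measure \<nu>"
    "\<And>f. f \<in> borel_measurable (R\<^sub>N \<Otimes>\<^sub>M R\<^sub>Y) \<Longrightarrow> N.hitting_integral f = (\<integral>\<^sup>+n. \<integral>\<^sup>+y. f (n, y) \<partial>\<nu> \<partial>m\<^sub>N)"
    using N.ex_transverse_measure by blast
  interpret semidirect_transverse_nu N L m\<^sub>G m\<^sub>N m\<^sub>L act Y Z \<mu> \<nu>
    by (intro semidirect_transverse_nu.intro semidirect_transverse_axioms semidirect_transverse_nu_axioms.intro \<nu>)
  have res_N: "transverse_measure N m\<^sub>N act Y \<mu> = \<nu>"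
    by (intro N.transverse_measure_eq N.is_transverse_measureI \<nu>)
  obtain \<rho> where \<rho>: "sets \<rho> = sets R\<^sub>Z" "finite_measure \<rho>"
    "\<And>f. f \<in> borel_measurable (R\<^sub>L \<Otimes>\<^sub>M R\<^sub>Z) \<Longrightarrow> L'.hitting_integral f = (\<integral>\<^sup>+l. \<integral>\<^sup>+z. f (l, z) \<partial>\<rho> \<partial>m\<^sub>L)"
    using L'.ex_transverse_measure by blast
  have res_L: "transverse_measure L m\<^sub>L act Z \<nu> = \<rho>"
    by (intro L.transverse_measure_eq L'.is_transverse_measureI \<rho>)
  interpret G: haar_subgroup UNIV m\<^sub>G
    by (intro haar_subgroup.intro assms) (simp add: closed_subgroup_def)
  have "is_transverse_measure UNIV m\<^sub>G act Z \<mu> \<rho>"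
    unfolding is_transverse_measure_def
  proof (intro conjI allI impI)
    fix f :: "'g \<times> 'x \<Rightarrow> real"
    assume "f \<in> borel_measurable (restrict_space borel UNIV \<Otimes>\<^sub>M R\<^sub>Z) \<and>
      (\<forall>p\<in>UNIV \<times> Z. 0 \<le> f p) \<and> bounded (f ` (UNIV \<times> Z))"
    then have "f \<in> borel_measurable (borel \<Otimes>\<^sub>M R\<^sub>Z)"
      by (simp add: measurable_cong_sets[OF sets_pair_measure_cong[OF sets_restrict_space_UNIV refl] refl])
    then have "(\<lambda>p. ennreal (f p)) \<in> borel_measurable (borel \<Otimes>\<^sub>M R\<^sub>Z)"
      by (rule measurable_compose[OF _ measurable_ennreal])
    from transverse_measure_composition[OF \<rho> this]
    show "(\<integral>\<^sup>+ s. (\<integral>\<^sup>+ h. ennreal (f (- h, act h s)) \<partial>count_space (hitting_set UNIV act Z s)) \<partial>\<mu>)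
        = (\<integral>\<^sup>+ h. (\<integral>\<^sup>+ t. ennreal (f (h, t)) \<partial>\<rho>) \<partial>m\<^sub>G)" .
  qed (fact \<rho>(1))
  then have "transverse_measure UNIV m\<^sub>G act Z \<mu> = \<rho>"
    by (rule G.transverse_measure_eq)
  moreover have "finite_invariant_borel_measure L act Y \<nu>"
    using \<nu>(1,2) nu_invariant by (simp add: finite_invariant_borel_measure_def)
  ultimately show ?thesis by (simp add: res_N res_L)
qed

end
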